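(* Let $k$ be a field, let $\mathcal{C}$ be a $k$-category and let $n$ be a positive integer. Then $\mathcal{C}$ and the matrix category $M_n(\mathcal{C})$ are Morita equivalent.
   Context: A $k$-category is a category whose objects form a set, whose morphism sets ${}_y\mathcal{C}_x$ (from $x$ to $y$) are $k$-vector spaces, and whose composition is $k$-bilinear. Functors and equivalences between $k$-linear categories are understood to be $k$-linear. A left $\mathcal{C}$-module is a $k$-linear covariant functor from $\mathcal{C}$ to $k$-vector spaces, with natural transformations as morphisms; two $k$-categories are Morita equivalent if their categories of left modules are equivalent. The matrix category $M_n(\mathcal{C})$ has the same objects as $\mathcal{C}$; the morphisms from $x$ to $y$ are the $n\times n$ matrices with entries in ${}_y\mathcal{C}_x$, and composition is the matrix product combined with the composition of $\mathcal{C}$. *)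

theory Defs
  imports
    "HOL-Algebra.Module"
    "HOL-Library.FuncSet"
    "HOL-Library.Infinite_Typeclass"
    "Jordan_Normal_Form.Matrix"
begin

text \<open>
  A vector space over a field \<open>K\<close> is a record \<open>V\<close> with \<open>module K V\<close>; the fields \<open>mult\<close> and \<open>one\<close>
  that records of this type inherit from rings are never used.
\<close>

definition linear_maps ::
  "('k, 'r) ring_scheme \<Rightarrow> ('k, 'v) module \<Rightarrow> ('k, 'w) module \<Rightarrow> ('v \<Rightarrow> 'w) set" where
  "linear_maps K V W = {f \<in> carrier V \<rightarrow> carrier W.
     (\<forall>u\<in>carrier V. \<forall>v\<in>carrier V. f (u \<oplus>\<^bsub>V\<^esub> v) = f u \<oplus>\<^bsub>W\<^esub> f v) \<and>
     (\<forall>a\<in>carrier K. \<forall>v\<in>carrier V. f (a \<odot>\<^bsub>V\<^esub> v) = a \<odot>\<^bsub>W\<^esub> f v)}"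

text \<open>
  \<open>Hom C x y\<close> is the space of morphisms from \<open>x\<close> to \<open>y\<close>, and \<open>Comp C x y z g f\<close> is the composite
  of \<open>f\<close> from \<open>x\<close> to \<open>y\<close> followed by \<open>g\<close> from \<open>y\<close> to \<open>z\<close>. Composition carries its objects as
  arguments, so distinct morphism spaces need not be disjoint.
\<close>

record ('o, 'm, 'k) kcat =
  Ob :: "'o set"
  Hom :: "'o \<Rightarrow> 'o \<Rightarrow> ('k, 'm) module"
  Comp :: "'o \<Rightarrow> 'o \<Rightarrow> 'o \<Rightarrow> 'm \<Rightarrow> 'm \<Rightarrow> 'm"
  Ident :: "'o \<Rightarrow> 'm"

locale kcategory = field K
  for K :: "('k, 'r) ring_scheme" and C :: "('o, 'm, 'k) kcat" +
  assumes Hom_module: "\<lbrakk>x \<in> Ob C; y \<in> Ob C\<rbrakk> \<Longrightarrow> module K (Hom C x y)"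
    and Ident_closed: "x \<in> Ob C \<Longrightarrow> Ident C x \<in> carrier (Hom C x x)"
    and Comp_linear_right: "\<lbrakk>x \<in> Ob C; y \<in> Ob C; z \<in> Ob C; g \<in> carrier (Hom C y z)\<rbrakk>
      \<Longrightarrow> (\<lambda>f. Comp C x y z g f) \<in> linear_maps K (Hom C x y) (Hom C x z)"
    and Comp_linear_left: "\<lbrakk>x \<in> Ob C; y \<in> Ob C; z \<in> Ob C; f \<in> carrier (Hom C x y)\<rbrakk>
      \<Longrightarrow> (\<lambda>g. Comp C x y z g f) \<in> linear_maps K (Hom C y z) (Hom C x z)"
    and Comp_assoc: "\<lbrakk>w \<in> Ob C; x \<in> Ob C; y \<in> Ob C; z \<in> Ob C;
        f \<in> carrier (Hom C w x); g \<in> carrier (Hom C x y); h \<in> carrier (Hom C y z)\<rbrakk>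
      \<Longrightarrow> Comp C w x z (Comp C x y z h g) f = Comp C w y z h (Comp C w x y g f)"
    and Comp_Ident_left: "\<lbrakk>x \<in> Ob C; y \<in> Ob C; f \<in> carrier (Hom C x y)\<rbrakk>
      \<Longrightarrow> Comp C x y y (Ident C y) f = f"
    and Comp_Ident_right: "\<lbrakk>x \<in> Ob C; y \<in> Ob C; f \<in> carrier (Hom C x y)\<rbrakk>
      \<Longrightarrow> Comp C x x y f (Ident C x) = f"

definition iso_in :: "('o, 'm, 'k) kcat \<Rightarrow> 'o \<Rightarrow> 'o \<Rightarrow> 'm \<Rightarrow> bool" where
  "iso_in C x y f \<longleftrightarrow> f \<in> carrier (Hom C x y) \<and>
     (\<exists>g\<in>carrier (Hom C y x). Comp C x y x g f = Ident C x \<and> Comp C y x y f g = Ident C y)"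

record ('o, 'm, 'p, 'q) kfun =
  on_ob :: "'o \<Rightarrow> 'p"
  on_hom :: "'o \<Rightarrow> 'o \<Rightarrow> 'm \<Rightarrow> 'q"

locale klinear_functor = src: kcategory K C + tgt: kcategory K D
  for K :: "('k, 'r) ring_scheme" and C :: "('o, 'm, 'k) kcat" and D :: "('p, 'q, 'k) kcat" +
  fixes F :: "('o, 'm, 'p, 'q) kfun"
  assumes on_ob_closed: "x \<in> Ob C \<Longrightarrow> on_ob F x \<in> Ob D"
    and on_hom_linear: "\<lbrakk>x \<in> Ob C; y \<in> Ob C\<rbrakk>
      \<Longrightarrow> on_hom F x y \<in> linear_maps K (Hom C x y) (Hom D (on_ob F x) (on_ob F y))"
    and on_hom_Comp: "\<lbrakk>x \<in> Ob C; y \<in> Ob C; z \<in> Ob C;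
        f \<in> carrier (Hom C x y); g \<in> carrier (Hom C y z)\<rbrakk>
      \<Longrightarrow> on_hom F x z (Comp C x y z g f) =
          Comp D (on_ob F x) (on_ob F y) (on_ob F z) (on_hom F y z g) (on_hom F x y f)"
    and on_hom_Ident: "x \<in> Ob C \<Longrightarrow> on_hom F x x (Ident C x) = Ident D (on_ob F x)"

definition id_functor :: "('o, 'm, 'o, 'm) kfun" where
  "id_functor = \<lparr>on_ob = (\<lambda>x. x), on_hom = (\<lambda>x y f. f)\<rparr>"

definition comp_functor ::
  "('p, 'q, 's, 't) kfun \<Rightarrow> ('o, 'm, 'p, 'q) kfun \<Rightarrow> ('o, 'm, 's, 't) kfun" where
  "comp_functor G F = \<lparr>on_ob = (\<lambda>x. on_ob G (on_ob F x)),
     on_hom = (\<lambda>x y f. on_hom G (on_ob F x) (on_ob F y) (on_hom F x y f))\<rparr>"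

text \<open>
  Families of components are extensional, so that two natural transformations are equal as soon as
  their components at all objects of \<open>C\<close> are equal.
\<close>

definition nat_trans ::
  "('o, 'm, 'k) kcat \<Rightarrow> ('p, 'q, 'k) kcat \<Rightarrow> ('o, 'm, 'p, 'q) kfun \<Rightarrow> ('o, 'm, 'p, 'q) kfun
    \<Rightarrow> ('o \<Rightarrow> 'q) set" where
  "nat_trans C D F G = {\<eta> \<in> (\<Pi>\<^sub>E x\<in>Ob C. carrier (Hom D (on_ob F x) (on_ob G x))).
     \<forall>x\<in>Ob C. \<forall>y\<in>Ob C. \<forall>f\<in>carrier (Hom C x y).
       Comp D (on_ob F x) (on_ob F y) (on_ob G y) (\<eta> y) (on_hom F x y f) =
       Comp D (on_ob F x) (on_ob G x) (on_ob G y) (on_hom G x y f) (\<eta> x)}"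

definition naturally_isomorphic ::
  "('o, 'm, 'k) kcat \<Rightarrow> ('p, 'q, 'k) kcat \<Rightarrow> ('o, 'm, 'p, 'q) kfun \<Rightarrow> ('o, 'm, 'p, 'q) kfun
    \<Rightarrow> bool" where
  "naturally_isomorphic C D F G \<longleftrightarrow>
     (\<exists>\<eta>\<in>nat_trans C D F G. \<forall>x\<in>Ob C. iso_in D (on_ob F x) (on_ob G x) (\<eta> x))"

definition klinearly_equivalent ::
  "('k, 'r) ring_scheme \<Rightarrow> ('o, 'm, 'k) kcat \<Rightarrow> ('p, 'q, 'k) kcat \<Rightarrow> bool" where
  "klinearly_equivalent K C D \<longleftrightarrow>
     (\<exists>F G. klinear_functor K C D F \<and> klinear_functor K D C G \<and>
        naturally_isomorphic C C (comp_functor G F) id_functor \<and>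
        naturally_isomorphic D D (comp_functor F G) id_functor)"

text \<open>
  The vector spaces whose underlying set is a set of elements of the type \<open>'v\<close>. The type plays
  the role of a universe; an infinite one is closed, up to isomorphism, under subspaces and finite
  powers. Linear maps are extensional functions, so that equality of morphisms is
  equality on the underlying set of the source.
\<close>

definition vect_cat ::
  "('k, 'r) ring_scheme \<Rightarrow> (('k, 'v) module, 'v \<Rightarrow> 'v, 'k) kcat" where
  "vect_cat K = \<lparr>
     Ob = {V. module K V},
     Hom = (\<lambda>V W. \<lparr>
       carrier = linear_maps K V W \<inter> extensional (carrier V),
       mult = undefined, one = undefined,
       zero = (\<lambda>v\<in>carrier V. \<zero>\<^bsub>W\<^esub>),
       add = (\<lambda>f g. \<lambda>v\<in>carrier V. f v \<oplus>\<^bsub>W\<^esub> g v),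
       smult = (\<lambda>a f. \<lambda>v\<in>carrier V. a \<odot>\<^bsub>W\<^esub> f v)\<rparr>),
     Comp = (\<lambda>U V W g f. \<lambda>u\<in>carrier U. g (f u)),
     Ident = (\<lambda>V. \<lambda>v\<in>carrier V. v)\<rparr>"

text \<open>
  Functors are not normalised outside \<open>C\<close>: two functors that agree on all objects and morphisms
  of \<open>C\<close> may be different objects here, but they are isomorphic ones.
\<close>

definition functor_cat ::
  "('k, 'r) ring_scheme \<Rightarrow> ('o, 'm, 'k) kcat \<Rightarrow> ('p, 'q, 'k) kcat
    \<Rightarrow> (('o, 'm, 'p, 'q) kfun, 'o \<Rightarrow> 'q, 'k) kcat" where
  "functor_cat K C D = \<lparr>
     Ob = {F. klinear_functor K C D F},
     Hom = (\<lambda>F G. \<lparr>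
       carrier = nat_trans C D F G,
       mult = undefined, one = undefined,
       zero = (\<lambda>x\<in>Ob C. \<zero>\<^bsub>Hom D (on_ob F x) (on_ob G x)\<^esub>),
       add = (\<lambda>\<eta> \<theta>. \<lambda>x\<in>Ob C. \<eta> x \<oplus>\<^bsub>Hom D (on_ob F x) (on_ob G x)\<^esub> \<theta> x),
       smult = (\<lambda>a \<eta>. \<lambda>x\<in>Ob C. a \<odot>\<^bsub>Hom D (on_ob F x) (on_ob G x)\<^esub> \<eta> x)\<rparr>),
     Comp = (\<lambda>F G H \<theta> \<eta>. \<lambda>x\<in>Ob C. Comp D (on_ob F x) (on_ob G x) (on_ob H x) (\<theta> x) (\<eta> x)),
     Ident = (\<lambda>F. \<lambda>x\<in>Ob C. Ident D (on_ob F x))\<rparr>"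

definition left_modules ::
  "'v itself \<Rightarrow> ('k, 'r) ring_scheme \<Rightarrow> ('o, 'm, 'k) kcat
    \<Rightarrow> (('o, 'm, ('k, 'v) module, 'v \<Rightarrow> 'v) kfun, 'o \<Rightarrow> 'v \<Rightarrow> 'v, 'k) kcat" where
  "left_modules _ K C = functor_cat K C (vect_cat K)"

definition morita_equivalent ::
  "'v itself \<Rightarrow> ('k, 'r) ring_scheme \<Rightarrow> ('o, 'm, 'k) kcat \<Rightarrow> ('p, 'q, 'k) kcat \<Rightarrow> bool" where
  "morita_equivalent U K C D \<longleftrightarrow>
     kcategory K C \<and> kcategory K D \<and>
     klinearly_equivalent K (left_modules U K C) (left_modules U K D)"

definition matrix_cat :: "nat \<Rightarrow> ('o, 'm, 'k) kcat \<Rightarrow> ('o, 'm mat, 'k) kcat" where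
  "matrix_cat n C = \<lparr>
     Ob = Ob C,
     Hom = (\<lambda>x y. \<lparr>
       carrier = {A \<in> carrier_mat n n. \<forall>i<n. \<forall>j<n. A $$ (i, j) \<in> carrier (Hom C x y)},
       mult = undefined, one = undefined,
       zero = mat n n (\<lambda>_. \<zero>\<^bsub>Hom C x y\<^esub>),
       add = (\<lambda>A B. mat n n (\<lambda>ij. A $$ ij \<oplus>\<^bsub>Hom C x y\<^esub> B $$ ij)),
       smult = (\<lambda>a A. mat n n (\<lambda>ij. a \<odot>\<^bsub>Hom C x y\<^esub> A $$ ij))\<rparr>),
     Comp = (\<lambda>x y z B A. mat n n (\<lambda>(i, j).
       \<Oplus>\<^bsub>Hom C x z\<^esub>l\<in>{..<n}. Comp C x y z (B $$ (i, l)) (A $$ (l, j)))),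
     Ident = (\<lambda>x. mat n n (\<lambda>(i, j). if i = j then Ident C x else \<zero>\<^bsub>Hom C x x\<^esub>))\<rparr>"

end

theory Submission
  imports Defs "Jordan_Normal_Form.Missing_Ring"
begin

text \<open>
  Let \<open>E\<^sub>i\<^sub>j\<close> denote elementary matrices. A \<open>C\<close>-module \<open>M\<close> gives the \<open>M\<^sub>n(C)\<close>-module \<open>x \<mapsto> M(x)\<^sup>n\<close>,
  on which matrices act by block matrices; an \<open>M\<^sub>n(C)\<close>-module \<open>N\<close> gives the \<open>C\<close>-module
  \<open>x \<mapsto> E\<^sub>0\<^sub>0 N(x)\<close>, on which \<open>f\<close> acts as \<open>f E\<^sub>0\<^sub>0\<close>. The first coordinate identifies \<open>E\<^sub>0\<^sub>0 M(x)\<^sup>n\<close>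
  with \<open>M(x)\<close>, and \<open>(v\<^sub>i) \<mapsto> \<Sum>\<^sub>i E\<^sub>i\<^sub>0 v\<^sub>i\<close> is an isomorphism from \<open>(E\<^sub>0\<^sub>0 N(x))\<^sup>n\<close> to \<open>N(x)\<close> with
  inverse \<open>v \<mapsto> (E\<^sub>0\<^sub>i v)\<close>. The argument only uses that the target category has \<open>n\<close>-fold powers (as
  biproducts) and split idempotents. For vector spaces carried by subsets of a type this requires
  coding \<open>n\<close>-tuples as single elements, which is possible because the type is infinite.
\<close>

text \<open>The corner unit \<open>E_00\<close> is a full idempotent:
  \<open>E_i0 E_00 E_0i = E_ii\<close>, and the \<open>E_ii\<close> sum to the identity. Idempotency
  yields a module on the corner, fullness recovers the whole module from it; the index 0 exists
  because \<open>n > 0\<close>. The equivalence is proved for functors into any k-category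
  \<open>D\<close> with chosen n-fold biproducts and chosen splittings of idempotents; vector spaces
  enter only as one such \<open>D\<close>. In this generality a functor from \<open>C\<close> to
  \<open>D\<close> extends entrywise to one from \<open>M_n(C)\<close> to \<open>M_n(D)\<close>, and
  block matrices form one fixed functor from \<open>M_n(D)\<close> to \<open>D\<close>, so the power
  module is a composite of functors. Composition carries its objects, so each rewrite has membership
  premises. Composites are kept nested to the right, and rules whose left side is a composite are
  repeated with an arbitrary further map behind them (names in \<open>_assoc\<close>), since right
  nesting hides the plain form. Equalities of maps into or out of powers are tested on
  coordinates.\<close>

section \<open>Modules and linear maps\<close>

text \<open>Negatives exist as soon as \<open>0\<close> acts as zero, because \<open>-1\<close> then acts as negation.\<close>

lemma moduleI_null:
  fixes K :: "('k, 'r) ring_scheme" (structure) and M :: "('k, 'v) module"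
  assumes "cring K"
    and add_closed: "\<And>x y. \<lbrakk>x \<in> carrier M; y \<in> carrier M\<rbrakk> \<Longrightarrow> x \<oplus>\<^bsub>M\<^esub> y \<in> carrier M"
    and zero_closed: "\<zero>\<^bsub>M\<^esub> \<in> carrier M"
    and assoc: "\<And>x y z. \<lbrakk>x \<in> carrier M; y \<in> carrier M; z \<in> carrier M\<rbrakk>
      \<Longrightarrow> (x \<oplus>\<^bsub>M\<^esub> y) \<oplus>\<^bsub>M\<^esub> z = x \<oplus>\<^bsub>M\<^esub> (y \<oplus>\<^bsub>M\<^esub> z)"
    and comm: "\<And>x y. \<lbrakk>x \<in> carrier M; y \<in> carrier M\<rbrakk> \<Longrightarrow> x \<oplus>\<^bsub>M\<^esub> y = y \<oplus>\<^bsub>M\<^esub> x"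
    and zero: "\<And>x. x \<in> carrier M \<Longrightarrow> \<zero>\<^bsub>M\<^esub> \<oplus>\<^bsub>M\<^esub> x = x"
    and smult_closed: "\<And>a x. \<lbrakk>a \<in> carrier K; x \<in> carrier M\<rbrakk> \<Longrightarrow> a \<odot>\<^bsub>M\<^esub> x \<in> carrier M"
    and l_distr: "\<And>a b x. \<lbrakk>a \<in> carrier K; b \<in> carrier K; x \<in> carrier M\<rbrakk>
      \<Longrightarrow> (a \<oplus> b) \<odot>\<^bsub>M\<^esub> x = a \<odot>\<^bsub>M\<^esub> x \<oplus>\<^bsub>M\<^esub> b \<odot>\<^bsub>M\<^esub> x"
    and r_distr: "\<And>a x y. \<lbrakk>a \<in> carrier K; x \<in> carrier M; y \<in> carrier M\<rbrakk>
      \<Longrightarrow> a \<odot>\<^bsub>M\<^esub> (x \<oplus>\<^bsub>M\<^esub> y) = a \<odot>\<^bsub>M\<^esub> x \<oplus>\<^bsub>M\<^esub> a \<odot>\<^bsub>M\<^esub> y"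
    and smult_assoc: "\<And>a b x. \<lbrakk>a \<in> carrier K; b \<in> carrier K; x \<in> carrier M\<rbrakk>
      \<Longrightarrow> (a \<otimes> b) \<odot>\<^bsub>M\<^esub> x = a \<odot>\<^bsub>M\<^esub> (b \<odot>\<^bsub>M\<^esub> x)"
    and one: "\<And>x. x \<in> carrier M \<Longrightarrow> \<one> \<odot>\<^bsub>M\<^esub> x = x"
    and null: "\<And>x. x \<in> carrier M \<Longrightarrow> \<zero> \<odot>\<^bsub>M\<^esub> x = \<zero>\<^bsub>M\<^esub>"
  shows "module K M"
proof -
  interpret K: cring K by fact
  have "\<exists>y\<in>carrier M. y \<oplus>\<^bsub>M\<^esub> x = \<zero>\<^bsub>M\<^esub>" if x: "x \<in> carrier M" for x
  proof
    show "(\<ominus> \<one>) \<odot>\<^bsub>M\<^esub> x \<in> carrier M" using x by (simp add: smult_closed)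
    show "(\<ominus> \<one>) \<odot>\<^bsub>M\<^esub> x \<oplus>\<^bsub>M\<^esub> x = \<zero>\<^bsub>M\<^esub>"
      using l_distr[of "\<ominus> \<one>" \<one> x] x by (simp add: one null K.l_neg)
  qed
  then have "abelian_group M"
    by (intro abelian_groupI) (auto simp: add_closed zero_closed assoc zero intro: comm)
  then show ?thesis
    by (intro moduleI) (auto simp: \<open>cring K\<close> smult_closed l_distr r_distr smult_assoc one)
qed

lemma linear_mapsI:
  assumes "\<And>v. v \<in> carrier V \<Longrightarrow> f v \<in> carrier W"
    and "\<And>u v. \<lbrakk>u \<in> carrier V; v \<in> carrier V\<rbrakk> \<Longrightarrow> f (u \<oplus>\<^bsub>V\<^esub> v) = f u \<oplus>\<^bsub>W\<^esub> f v"
    and "\<And>a v. \<lbrakk>a \<in> carrier K; v \<in> carrier V\<rbrakk> \<Longrightarrow> f (a \<odot>\<^bsub>V\<^esub> v) = a \<odot>\<^bsub>W\<^esub> f v"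
  shows "f \<in> linear_maps K V W"
  using assms by (auto simp: linear_maps_def)

lemma linear_mapsD:
  assumes "f \<in> linear_maps K V W"
  shows "v \<in> carrier V \<Longrightarrow> f v \<in> carrier W"
    and "\<lbrakk>u \<in> carrier V; v \<in> carrier V\<rbrakk> \<Longrightarrow> f (u \<oplus>\<^bsub>V\<^esub> v) = f u \<oplus>\<^bsub>W\<^esub> f v"
    and "\<lbrakk>a \<in> carrier K; v \<in> carrier V\<rbrakk> \<Longrightarrow> f (a \<odot>\<^bsub>V\<^esub> v) = a \<odot>\<^bsub>W\<^esub> f v"
  using assms by (auto simp: linear_maps_def)

lemma linear_maps_zero:
  assumes "f \<in> linear_maps K V W" "module K V" "module K W"
  shows "f \<zero>\<^bsub>V\<^esub> = \<zero>\<^bsub>W\<^esub>"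
proof -
  interpret V: module K V by fact
  interpret W: module K W by fact
  have "f \<zero>\<^bsub>V\<^esub> = f (\<zero>\<^bsub>K\<^esub> \<odot>\<^bsub>V\<^esub> \<zero>\<^bsub>V\<^esub>)" by simp
  also have "\<dots> = \<zero>\<^bsub>K\<^esub> \<odot>\<^bsub>W\<^esub> f \<zero>\<^bsub>V\<^esub>"
    using linear_mapsD(3)[OF assms(1)] by blast
  also have "\<dots> = \<zero>\<^bsub>W\<^esub>" using linear_mapsD(1)[OF assms(1)] by simp
  finally show ?thesis .
qed

lemma linear_maps_finsum:
  assumes "f \<in> linear_maps K V W" "module K V" "module K W"
    and "finite I" "g \<in> I \<rightarrow> carrier V"
  shows "f (\<Oplus>\<^bsub>V\<^esub>i\<in>I. g i) = (\<Oplus>\<^bsub>W\<^esub>i\<in>I. f (g i))"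
proof -
  interpret V: module K V by fact
  interpret W: module K W by fact
  note f = linear_mapsD[OF assms(1)]
  show ?thesis using assms(4,5)
  proof (induction I rule: finite_induct)
    case empty
    then show ?case using linear_maps_zero[OF assms(1-3)] by simp
  next
    case (insert i I)
    then have "f (finsum V g (insert i I)) = f (g i) \<oplus>\<^bsub>W\<^esub> f (finsum V g I)"
      by (subst V.M.finsum_insert) (auto simp: f intro!: f V.M.finsum_closed)
    also have "\<dots> = (\<Oplus>\<^bsub>W\<^esub>i\<in>insert i I. f (g i))"
      using insert by (subst W.M.finsum_insert) (auto simp: f Pi_iff)
    finally show ?case .
  qed
qed

lemma linear_maps_comp:
  assumes "f \<in> linear_maps K U V" "g \<in> linear_maps K V W"
  shows "(\<lambda>u. g (f u)) \<in> linear_maps K U W"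
  using assms by (auto simp: linear_maps_def Pi_iff)

text \<open>A derivation of the fold relation for \<open>A\<close> applies the function only to
  elements of \<open>A\<close>, so it can be replayed with any function that agrees there.\<close>

lemma foldSetD_cong:
  assumes "(A, y) \<in> foldSetD D f e" "\<And>i. i \<in> A \<Longrightarrow> f i = g i"
  shows "(A, y) \<in> foldSetD D g e"
  using assms
proof (induction A y rule: foldSetD.induct)
  case (insertI x A y)
  then show ?case using foldSetD.insertI[of x A g y D e] by simp
qed (rule foldSetD.emptyI)

context abelian_monoid
begin

lemma finsum_delta:
  assumes "finite A" "i \<in> A" "f i \<in> carrier G"
  shows "(\<Oplus>j\<in>A. if j = i then f j else \<zero>) = f i"
proof -
  have "(\<Oplus>j\<in>A. if j = i then f j else \<zero>) = (\<Oplus>j\<in>A. if i = j then f i else \<zero>)"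
    using assms by (intro finsum_cong') auto
  also have "\<dots> = f i" using assms by (intro finsum_singleton) auto
  finally show ?thesis .
qed

lemma finsum_swap:
  assumes "finite A" "finite B" "\<And>i j. \<lbrakk>i \<in> A; j \<in> B\<rbrakk> \<Longrightarrow> f i j \<in> carrier G"
  shows "(\<Oplus>i\<in>A. \<Oplus>j\<in>B. f i j) = (\<Oplus>j\<in>B. \<Oplus>i\<in>A. f i j)"
  using assms by (intro add.finprod_finprod_swap) auto

end

text \<open>Unlike \<open>finsum_cong\<close>, this needs no closure condition: \<open>finsum\<close> only inspects its argument on
  the index set.\<close>

lemma finsum_cong_index:
  assumes "I = J" and "\<And>i. i \<in> J \<Longrightarrow> f i = g i"
  shows "finsum G f I = finsum G g J"
proof -
  have "(J, y) \<in> foldSetD (carrier G) (add G \<circ> f) \<zero>\<^bsub>G\<^esub> \<longleftrightarrow>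
      (J, y) \<in> foldSetD (carrier G) (add G \<circ> g) \<zero>\<^bsub>G\<^esub>" for y
    using foldSetD_cong[of J y _ "add G \<circ> f" _ "add G \<circ> g"]
      foldSetD_cong[of J y _ "add G \<circ> g" _ "add G \<circ> f"] assms(2)
    by auto
  then show ?thesis using assms(1) by (simp add: finsum_def finprod_def foldD_def)
qed

text \<open>As a congruence rule this gives the simplifier \<open>i \<in> J\<close> while it
  rewrites a summand. The matrix computations depend on it: the bound on the summation index is what
  makes entries readable.\<close>

lemma finsum_cong_simp [cong]:
  "\<lbrakk>I = J; \<And>i. i \<in> J =simp=> f i = g i\<rbrakk> \<Longrightarrow> finsum G f I = finsum G g J"
  by (rule finsum_cong_index) (simp_all add: simp_implies_def)

text \<open>Multiplication by a fixed scalar is itself linear, because the scalars commute, so sums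
  pass through it as through any linear map.\<close>

lemma module_smult_finsum:
  fixes M :: "('k, 'v) module"
  assumes "module R M" and "finite A" "a \<in> carrier R" "f \<in> A \<rightarrow> carrier M"
  shows "a \<odot>\<^bsub>M\<^esub> (\<Oplus>\<^bsub>M\<^esub>i\<in>A. f i) = (\<Oplus>\<^bsub>M\<^esub>i\<in>A. a \<odot>\<^bsub>M\<^esub> f i)"
proof -
  interpret module R M by fact
  have "(\<lambda>v. a \<odot>\<^bsub>M\<^esub> v) \<in> linear_maps R M M"
    using assms(3)
    by (intro linear_mapsI) (auto simp: smult_r_distr smult_assoc1[symmetric] R.m_comm)
  from linear_maps_finsum[OF this module_axioms module_axioms assms(2,4)] show ?thesis by simp
qed

section \<open>Matrix categories\<close>

context kcategory
begin

lemma Hom_abelian_group: "\<lbrakk>x \<in> Ob C; y \<in> Ob C\<rbrakk> \<Longrightarrow> abelian_group (Hom C x y)"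
  using Hom_module module.axioms(2) by blast

lemma Hom_abelian_monoid: "\<lbrakk>x \<in> Ob C; y \<in> Ob C\<rbrakk> \<Longrightarrow> abelian_monoid (Hom C x y)"
  using Hom_abelian_group abelian_group.axioms(1) by blast

text \<open>General facts on modules, turned into rules with membership of objects as premises, so
  that they rewrite in all hom spaces at once without an interpretation for each.\<close>

lemmas Hom_add_closed [simp] = abelian_monoid.a_closed[OF Hom_abelian_monoid]
lemmas Hom_zero_closed [simp] = abelian_monoid.zero_closed[OF Hom_abelian_monoid]
lemmas Hom_smult_closed [simp] = module.smult_closed[OF Hom_module]
lemmas Hom_l_zero [simp] = abelian_monoid.l_zero[OF Hom_abelian_monoid]
lemmas Hom_r_zero [simp] = abelian_monoid.r_zero[OF Hom_abelian_monoid]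
lemmas Hom_finsum_zero [simp] = abelian_monoid.finsum_zero[OF Hom_abelian_monoid]
lemmas Hom_finsum_delta = abelian_monoid.finsum_delta[OF Hom_abelian_monoid]
lemmas Hom_finsum_swap = abelian_monoid.finsum_swap[OF Hom_abelian_monoid]
lemmas Hom_finsum_add = abelian_monoid.finsum_addf[OF Hom_abelian_monoid]
lemmas Hom_smult_finsum = module_smult_finsum[OF Hom_module]
lemmas Hom_smult_zero [simp] = module.smult_r_null[OF Hom_module]

lemmas Hom_finsum_closed [simp] = abelian_monoid.finsum_closed[OF Hom_abelian_monoid]

lemma Comp_closed [simp]:
  "\<lbrakk>x \<in> Ob C; y \<in> Ob C; z \<in> Ob C; f \<in> carrier (Hom C x y); g \<in> carrier (Hom C y z)\<rbrakk>
    \<Longrightarrow> Comp C x y z g f \<in> carrier (Hom C x z)"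
  using linear_mapsD(1)[OF Comp_linear_right] by blast

lemmas Comp_add_right = linear_mapsD(2)[OF Comp_linear_right]
lemmas Comp_smult_right = linear_mapsD(3)[OF Comp_linear_right]
lemmas Comp_add_left = linear_mapsD(2)[OF Comp_linear_left]
lemmas Comp_smult_left = linear_mapsD(3)[OF Comp_linear_left]

declare Ident_closed [simp] Comp_Ident_left [simp] Comp_Ident_right [simp]

lemma Comp_zero_right [simp]:
  "\<lbrakk>x \<in> Ob C; y \<in> Ob C; z \<in> Ob C; g \<in> carrier (Hom C y z)\<rbrakk>
    \<Longrightarrow> Comp C x y z g \<zero>\<^bsub>Hom C x y\<^esub> = \<zero>\<^bsub>Hom C x z\<^esub>"
  using linear_maps_zero[OF Comp_linear_right Hom_module Hom_module] by blast

lemma Comp_zero_left [simp]: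
  "\<lbrakk>x \<in> Ob C; y \<in> Ob C; z \<in> Ob C; f \<in> carrier (Hom C x y)\<rbrakk>
    \<Longrightarrow> Comp C x y z \<zero>\<^bsub>Hom C y z\<^esub> f = \<zero>\<^bsub>Hom C x z\<^esub>"
  using linear_maps_zero[OF Comp_linear_left Hom_module Hom_module] by blast

lemma Comp_finsum_right:
  "\<lbrakk>x \<in> Ob C; y \<in> Ob C; z \<in> Ob C; g \<in> carrier (Hom C y z); finite I;
    f \<in> I \<rightarrow> carrier (Hom C x y)\<rbrakk>
    \<Longrightarrow> Comp C x y z g (\<Oplus>\<^bsub>Hom C x y\<^esub>i\<in>I. f i) = (\<Oplus>\<^bsub>Hom C x z\<^esub>i\<in>I. Comp C x y z g (f i))"
  using linear_maps_finsum[OF Comp_linear_right Hom_module Hom_module, of x y z g I f] by blast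

lemma Comp_finsum_left:
  "\<lbrakk>x \<in> Ob C; y \<in> Ob C; z \<in> Ob C; f \<in> carrier (Hom C x y); finite I;
    g \<in> I \<rightarrow> carrier (Hom C y z)\<rbrakk>
    \<Longrightarrow> Comp C x y z (\<Oplus>\<^bsub>Hom C y z\<^esub>i\<in>I. g i) f = (\<Oplus>\<^bsub>Hom C x z\<^esub>i\<in>I. Comp C x y z (g i) f)"
  using linear_maps_finsum[OF Comp_linear_left Hom_module Hom_module, of x y z f I g] by blast

end

lemma matrix_cat_simps [simp]:
  "Ob (matrix_cat n C) = Ob C"
  "carrier (Hom (matrix_cat n C) x y) =
    {A \<in> carrier_mat n n. \<forall>i<n. \<forall>j<n. A $$ (i, j) \<in> carrier (Hom C x y)}"
  "\<zero>\<^bsub>Hom (matrix_cat n C) x y\<^esub> = mat n n (\<lambda>_. \<zero>\<^bsub>Hom C x y\<^esub>)"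
  "A \<oplus>\<^bsub>Hom (matrix_cat n C) x y\<^esub> B = mat n n (\<lambda>ij. A $$ ij \<oplus>\<^bsub>Hom C x y\<^esub> B $$ ij)"
  "a \<odot>\<^bsub>Hom (matrix_cat n C) x y\<^esub> A = mat n n (\<lambda>ij. a \<odot>\<^bsub>Hom C x y\<^esub> A $$ ij)"
  "Comp (matrix_cat n C) x y z B A = mat n n (\<lambda>(i, j).
     \<Oplus>\<^bsub>Hom C x z\<^esub>l\<in>{..<n}. Comp C x y z (B $$ (i, l)) (A $$ (l, j)))"
  "Ident (matrix_cat n C) x = mat n n (\<lambda>(i, j). if i = j then Ident C x else \<zero>\<^bsub>Hom C x x\<^esub>)"
  by (simp_all add: matrix_cat_def)

context kcategory
begin

lemma matrix_Hom_module:
  assumes "x \<in> Ob C" "y \<in> Ob C"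
  shows "module K (Hom (matrix_cat n C) x y)"
proof -
  interpret H: module K "Hom C x y" using assms by (rule Hom_module)
  show ?thesis
    by (intro moduleI_null)
      (auto intro!: eq_matI simp: is_cring H.M.a_assoc H.smult_l_distr H.smult_r_distr
        H.smult_assoc1 H.M.a_ac)
qed

text \<open>All laws are checked entry by entry. Bilinearity comes from additivity of finite sums,
  the identity laws from sums with a single nonzero term, associativity from exchanging two
  sums.\<close>

lemma matrix_kcategory: "kcategory K (matrix_cat n C)"
proof (intro kcategory.intro kcategory_axioms.intro, goal_cases)
  case 1
  show ?case by (rule field_axioms)
next
  case (2 x y)
  then show ?case by (simp add: matrix_Hom_module)
next
  case (3 x)
  then show ?case by simp
next
  case (4 x y z g)
  then have [simp]: "x \<in> Ob C" "y \<in> Ob C" "z \<in> Ob C" by simp_all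
  show ?case
  proof (rule linear_mapsI, goal_cases)
    case (1 v)
    then show ?case using 4 by (auto simp: Pi_iff)
  next
    case (2 u v)
    show ?case
    proof (rule eq_matI, goal_cases)
      case (1 i j)
      then have "i < n" "j < n" by simp_all
      then show ?case using 4 2
        by (simp add: Hom_finsum_add[symmetric] Pi_iff Comp_add_right)
    qed simp_all
  next
    case (3 a v)
    show ?case
    proof (rule eq_matI, goal_cases)
      case (1 i j)
      then have "i < n" "j < n" by simp_all
      then show ?case using 4 3
        by (simp add: Hom_smult_finsum Pi_iff Comp_smult_right)
    qed simp_all
  qed
next
  case (5 x y z f)
  then have [simp]: "x \<in> Ob C" "y \<in> Ob C" "z \<in> Ob C" by simp_all
  show ?case
  proof (rule linear_mapsI, goal_cases)
    case (1 v)
    then show ?case using 5 by (auto simp: Pi_iff)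
  next
    case (2 u v)
    show ?case
    proof (rule eq_matI, goal_cases)
      case (1 i j)
      then have "i < n" "j < n" by simp_all
      then show ?case using 5 2
        by (simp add: Hom_finsum_add[symmetric] Pi_iff Comp_add_left)
    qed simp_all
  next
    case (3 a v)
    show ?case
    proof (rule eq_matI, goal_cases)
      case (1 i j)
      then have "i < n" "j < n" by simp_all
      then show ?case using 5 3
        by (simp add: Hom_smult_finsum Pi_iff Comp_smult_left)
    qed simp_all
  qed
next
  case (6 w x y z f g h)
  then have [simp]: "w \<in> Ob C" "x \<in> Ob C" "y \<in> Ob C" "z \<in> Ob C" by simp_all
  show ?case
  proof (rule eq_matI, goal_cases)
    case (1 i j)
    then have ij: "i < n" "j < n" by simp_all
    have "(\<Oplus>\<^bsub>Hom C w z\<^esub>l\<in>{..<n}. Comp C w x z (Comp (matrix_cat n C) x y z h g $$ (i, l)) (f $$ (l, j))) =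
        (\<Oplus>\<^bsub>Hom C w z\<^esub>l\<in>{..<n}. \<Oplus>\<^bsub>Hom C w z\<^esub>m\<in>{..<n}.
          Comp C w y z (h $$ (i, m)) (Comp C w x y (g $$ (m, l)) (f $$ (l, j))))"
      using 6 ij by (simp add: Pi_iff Comp_finsum_left Comp_assoc)
    \<comment> \<open>The two bracketings of the triple product differ only in the order of
      summation over the two inner indices.\<close>
    also have "\<dots> = (\<Oplus>\<^bsub>Hom C w z\<^esub>m\<in>{..<n}. \<Oplus>\<^bsub>Hom C w z\<^esub>l\<in>{..<n}.
          Comp C w y z (h $$ (i, m)) (Comp C w x y (g $$ (m, l)) (f $$ (l, j))))"
      using 6 ij by (intro Hom_finsum_swap) (auto simp: Pi_iff)
    also have "\<dots> = (\<Oplus>\<^bsub>Hom C w z\<^esub>m\<in>{..<n}. Comp C w y z (h $$ (i, m)) (Comp (matrix_cat n C) w x y g f $$ (m, j)))"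
      using 6 ij by (simp add: Pi_iff Comp_finsum_right)
    finally show ?case using ij by simp
  qed simp_all
next
  case (7 x y f)
  then have [simp]: "x \<in> Ob C" "y \<in> Ob C" by simp_all
  show ?case
  proof (rule eq_matI, goal_cases)
    case (1 i j)
    then have ij: "i < n" "j < n" using 7 by auto
    have "(\<Oplus>\<^bsub>Hom C x y\<^esub>l\<in>{..<n}. Comp C x y y (Ident (matrix_cat n C) y $$ (i, l)) (f $$ (l, j))) =
        (\<Oplus>\<^bsub>Hom C x y\<^esub>l\<in>{..<n}. if l = i then f $$ (l, j) else \<zero>\<^bsub>Hom C x y\<^esub>)"
      using 7 ij by (intro finsum_cong_index) auto
    also have "\<dots> = f $$ (i, j)"
      using 7 ij by (intro Hom_finsum_delta) auto
    finally show ?case using ij by simp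
  qed (use 7 in auto)
next
  case (8 x y f)
  then have [simp]: "x \<in> Ob C" "y \<in> Ob C" by simp_all
  show ?case
  proof (rule eq_matI, goal_cases)
    case (1 i j)
    then have ij: "i < n" "j < n" using 8 by auto
    have "(\<Oplus>\<^bsub>Hom C x y\<^esub>l\<in>{..<n}. Comp C x x y (f $$ (i, l)) (Ident (matrix_cat n C) x $$ (l, j))) =
        (\<Oplus>\<^bsub>Hom C x y\<^esub>l\<in>{..<n}. if l = j then f $$ (i, l) else \<zero>\<^bsub>Hom C x y\<^esub>)"
      using 8 ij by (intro finsum_cong_index) auto
    also have "\<dots> = f $$ (i, j)"
      using 8 ij by (intro Hom_finsum_delta) auto
    finally show ?case using ij by simp
  qed (use 8 in auto)
qed

end

section \<open>Functor categories\<close>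

context klinear_functor
begin

declare on_ob_closed [simp]

lemma on_hom_closed [simp]:
  "\<lbrakk>x \<in> Ob C; y \<in> Ob C; f \<in> carrier (Hom C x y)\<rbrakk>
    \<Longrightarrow> on_hom F x y f \<in> carrier (Hom D (on_ob F x) (on_ob F y))"
  using linear_mapsD(1)[OF on_hom_linear] by blast

lemmas on_hom_add = linear_mapsD(2)[OF on_hom_linear]
lemmas on_hom_smult = linear_mapsD(3)[OF on_hom_linear]

lemma on_hom_zero [simp]:
  "\<lbrakk>x \<in> Ob C; y \<in> Ob C\<rbrakk> \<Longrightarrow>
    on_hom F x y \<zero>\<^bsub>Hom C x y\<^esub> = \<zero>\<^bsub>Hom D (on_ob F x) (on_ob F y)\<^esub>"
  by (rule linear_maps_zero[OF on_hom_linear src.Hom_module tgt.Hom_module]) simp_all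

lemma on_hom_finsum:
  "\<lbrakk>x \<in> Ob C; y \<in> Ob C; finite I; f \<in> I \<rightarrow> carrier (Hom C x y)\<rbrakk> \<Longrightarrow>
    on_hom F x y (\<Oplus>\<^bsub>Hom C x y\<^esub>i\<in>I. f i) =
    (\<Oplus>\<^bsub>Hom D (on_ob F x) (on_ob F y)\<^esub>i\<in>I. on_hom F x y (f i))"
  by (rule linear_maps_finsum[OF on_hom_linear src.Hom_module tgt.Hom_module]) simp_all

end

text \<open>Bundles to be instantiated with \<open>OF\<close>: later proofs involve several
  categories and functors at a time, each of which contributes its own copy of these rules.\<close>

lemmas kcategory_simps = kcategory.Hom_add_closed kcategory.Hom_zero_closed
  kcategory.Hom_smult_closed kcategory.Hom_l_zero kcategory.Hom_r_zero kcategory.Hom_finsum_zero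
  kcategory.Hom_finsum_closed kcategory.Hom_smult_zero kcategory.Ident_closed kcategory.Comp_closed
  kcategory.Comp_Ident_left kcategory.Comp_Ident_right kcategory.Comp_zero_left
  kcategory.Comp_zero_right

lemmas kcategory_linear = kcategory.Comp_add_left kcategory.Comp_add_right
  kcategory.Comp_smult_left kcategory.Comp_smult_right

lemmas klinear_functor_simps = klinear_functor.on_ob_closed klinear_functor.on_hom_closed
  klinear_functor.on_hom_zero klinear_functor.on_hom_Ident

lemmas klinear_functor_linear = klinear_functor.on_hom_add klinear_functor.on_hom_smult

lemma klinear_functorD:
  assumes "klinear_functor K C D F"
  shows "kcategory K C" "kcategory K D"
  using assms by (auto simp: klinear_functor_def)

lemma comp_functor_simps [simp]:
  "on_ob (comp_functor G F) x = on_ob G (on_ob F x)"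
  "on_hom (comp_functor G F) x y f = on_hom G (on_ob F x) (on_ob F y) (on_hom F x y f)"
  by (simp_all add: comp_functor_def)

lemma id_functor_simps [simp]: "on_ob id_functor x = x" "on_hom id_functor x y f = f"
  by (simp_all add: id_functor_def)

lemma klinear_functor_comp:
  assumes "klinear_functor K C D F" "klinear_functor K D E G"
  shows "klinear_functor K C E (comp_functor G F)"
proof -
  note [simp] = assms[THEN klinear_functorD(1)] assms[THEN klinear_functorD(2)]
    klinear_functor_simps[OF assms(1)] klinear_functor_simps[OF assms(2)]
    klinear_functor_linear[OF assms(1)] klinear_functor_linear[OF assms(2)]
    klinear_functor.on_hom_Comp[OF assms(1)] klinear_functor.on_hom_Comp[OF assms(2)]
  show ?thesis
    by (intro klinear_functor.intro klinear_functor_axioms.intro linear_mapsI) simp_all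
qed

lemma nat_transI:
  assumes "\<And>x. x \<in> Ob C \<Longrightarrow> \<eta> x \<in> carrier (Hom D (on_ob F x) (on_ob G x))"
    and "\<eta> \<in> extensional (Ob C)"
    and "\<And>x y f. \<lbrakk>x \<in> Ob C; y \<in> Ob C; f \<in> carrier (Hom C x y)\<rbrakk> \<Longrightarrow>
       Comp D (on_ob F x) (on_ob F y) (on_ob G y) (\<eta> y) (on_hom F x y f) =
       Comp D (on_ob F x) (on_ob G x) (on_ob G y) (on_hom G x y f) (\<eta> x)"
  shows "\<eta> \<in> nat_trans C D F G"
  using assms by (auto simp: nat_trans_def PiE_def)

lemma nat_trans_closed:
  "\<lbrakk>\<eta> \<in> nat_trans C D F G; x \<in> Ob C\<rbrakk> \<Longrightarrow> \<eta> x \<in> carrier (Hom D (on_ob F x) (on_ob G x))"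
  by (auto simp: nat_trans_def)

lemma nat_trans_extensional: "\<eta> \<in> nat_trans C D F G \<Longrightarrow> \<eta> \<in> extensional (Ob C)"
  by (auto simp: nat_trans_def PiE_def)

lemma nat_trans_naturality:
  "\<lbrakk>\<eta> \<in> nat_trans C D F G; x \<in> Ob C; y \<in> Ob C; f \<in> carrier (Hom C x y)\<rbrakk> \<Longrightarrow>
     Comp D (on_ob F x) (on_ob F y) (on_ob G y) (\<eta> y) (on_hom F x y f) =
     Comp D (on_ob F x) (on_ob G x) (on_ob G y) (on_hom G x y f) (\<eta> x)"
  by (auto simp: nat_trans_def)

lemma nat_trans_restrict_eqI:
  "\<lbrakk>\<eta> \<in> nat_trans C D F G; \<And>x. x \<in> Ob C \<Longrightarrow> \<theta> x = \<eta> x\<rbrakk> \<Longrightarrow> restrict \<theta> (Ob C) = \<eta>"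
  using nat_trans_extensional[of \<eta> C D F G] by (auto simp: fun_eq_iff extensional_def)

lemma functor_cat_simps [simp]:
  "F \<in> Ob (functor_cat K C D) \<longleftrightarrow> klinear_functor K C D F"
  "carrier (Hom (functor_cat K C D) F G) = nat_trans C D F G"
  "\<zero>\<^bsub>Hom (functor_cat K C D) F G\<^esub> = (\<lambda>x\<in>Ob C. \<zero>\<^bsub>Hom D (on_ob F x) (on_ob G x)\<^esub>)"
  "\<eta> \<oplus>\<^bsub>Hom (functor_cat K C D) F G\<^esub> \<theta> =
    (\<lambda>x\<in>Ob C. \<eta> x \<oplus>\<^bsub>Hom D (on_ob F x) (on_ob G x)\<^esub> \<theta> x)"
  "a \<odot>\<^bsub>Hom (functor_cat K C D) F G\<^esub> \<eta> =
    (\<lambda>x\<in>Ob C. a \<odot>\<^bsub>Hom D (on_ob F x) (on_ob G x)\<^esub> \<eta> x)"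
  "Comp (functor_cat K C D) F G H \<theta> \<eta> =
    (\<lambda>x\<in>Ob C. Comp D (on_ob F x) (on_ob G x) (on_ob H x) (\<theta> x) (\<eta> x))"
  "Ident (functor_cat K C D) F = (\<lambda>x\<in>Ob C. Ident D (on_ob F x))"
  by (simp_all add: functor_cat_def)

declare nat_trans_closed [simp]

text \<open>Naturality is a linear condition on the components, since composition in
  \<open>D\<close> is bilinear; the module laws themselves hold at each object separately.\<close>

lemma functor_Hom_module:
  assumes "klinear_functor K C D F" "klinear_functor K C D G"
  shows "module K (Hom (functor_cat K C D) F G)"
proof -
  note D = klinear_functorD(2)[OF assms(1)]
  note [simp] = klinear_functor_simps[OF assms(1)] klinear_functor_simps[OF assms(2)]
    kcategory_simps[OF D]
  let ?H = "Hom (functor_cat K C D) F G"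
  have add: "\<eta> \<oplus>\<^bsub>?H\<^esub> \<theta> \<in> carrier ?H" if "\<eta> \<in> carrier ?H" "\<theta> \<in> carrier ?H" for \<eta> \<theta>
    using that by (auto intro!: nat_transI
        simp: kcategory_linear[OF D] nat_trans_naturality)
  have smult: "a \<odot>\<^bsub>?H\<^esub> \<eta> \<in> carrier ?H" if "a \<in> carrier K" "\<eta> \<in> carrier ?H" for a \<eta>
    using that by (auto intro!: nat_transI
        simp: kcategory_linear[OF D] nat_trans_naturality)
  have zero: "\<zero>\<^bsub>?H\<^esub> \<in> carrier ?H"
    by (auto intro!: nat_transI)
  have mod: "module K (Hom D (on_ob F x) (on_ob G x))" if "x \<in> Ob C" for x
    using that by (simp add: kcategory.Hom_module[OF D])
  have am: "abelian_monoid (Hom D (on_ob F x) (on_ob G x))" if "x \<in> Ob C" for x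
    using that by (simp add: kcategory.Hom_abelian_monoid[OF D])
  show ?thesis
  proof (rule moduleI_null, goal_cases)
    case 1
    show ?case using kcategory.axioms(1)[OF D] by (simp add: field_def domain_def)
  next
    case (2 \<eta> \<theta>)
    then show ?case by (rule add)
  next
    case 3
    show ?case by (rule zero)
  next
    case (4 \<eta> \<theta> \<zeta>)
    then show ?case by (auto intro!: restrict_ext abelian_monoid.a_assoc[OF am])
  next
    case (5 \<eta> \<theta>)
    then show ?case by (auto intro!: restrict_ext abelian_monoid.a_comm[OF am])
  next
    case (6 \<eta>)
    then show ?case by (auto intro!: nat_trans_restrict_eqI[of \<eta>])
  next
    case (7 a \<eta>)
    then show ?case by (rule smult)
  next
    case (8 a b \<eta>)
    then show ?case by (auto intro!: restrict_ext module.smult_l_distr[OF mod])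
  next
    case (9 a \<eta> \<theta>)
    then show ?case by (auto intro!: restrict_ext module.smult_r_distr[OF mod])
  next
    case (10 a b \<eta>)
    then show ?case by (auto intro!: restrict_ext module.smult_assoc1[OF mod])
  next
    case (11 \<eta>)
    then show ?case by (auto intro!: nat_trans_restrict_eqI[of \<eta>] module.smult_one[OF mod])
  next
    case (12 \<eta>)
    then show ?case by (auto intro!: restrict_ext module.smult_l_null[OF mod])
  qed
qed

text \<open>The laws are inherited componentwise from \<open>D\<close>. The substance is the local
  fact \<open>comp\<close>: a composite of natural transformations is natural, by pasting two
  naturality squares.\<close>

lemma functor_kcategory:
  assumes "kcategory K D"
  shows "kcategory K (functor_cat K C D)"
proof -
  note D = assms
  note [simp] = kcategory_simps[OF D]
  have comp: "Comp (functor_cat K C D) F G H \<theta> \<eta> \<in> nat_trans C D F H"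
    if "klinear_functor K C D F" "klinear_functor K C D G" "klinear_functor K C D H"
      "\<eta> \<in> nat_trans C D F G" "\<theta> \<in> nat_trans C D G H" for F G H \<eta> \<theta>
  proof -
    note [simp] = klinear_functor_simps[OF that(1)] klinear_functor_simps[OF that(2)]
      klinear_functor_simps[OF that(3)]
    show ?thesis
    proof (rule nat_transI, goal_cases)
      case (3 x y f)
      have "Comp D (on_ob F x) (on_ob F y) (on_ob H y)
          (Comp D (on_ob F y) (on_ob G y) (on_ob H y) (\<theta> y) (\<eta> y)) (on_hom F x y f) =
        Comp D (on_ob F x) (on_ob G y) (on_ob H y) (\<theta> y)
          (Comp D (on_ob F x) (on_ob G x) (on_ob G y) (on_hom G x y f) (\<eta> x))"
        using 3 that(4,5) by (simp add: kcategory.Comp_assoc[OF D] nat_trans_naturality)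
      also have "\<dots> = Comp D (on_ob F x) (on_ob G x) (on_ob H y)
          (Comp D (on_ob G x) (on_ob G y) (on_ob H y) (\<theta> y) (on_hom G x y f)) (\<eta> x)"
        using 3 that(4,5) by (simp add: kcategory.Comp_assoc[OF D])
      also have "\<dots> = Comp D (on_ob F x) (on_ob H x) (on_ob H y) (on_hom H x y f)
          (Comp D (on_ob F x) (on_ob G x) (on_ob H x) (\<theta> x) (\<eta> x))"
        using 3 that(4,5) by (simp add: kcategory.Comp_assoc[OF D] nat_trans_naturality)
      finally show ?case using 3 by simp
    qed (use that(4,5) in auto)
  qed
  show ?thesis
  proof (intro kcategory.intro kcategory_axioms.intro, goal_cases)
    case 1
    show ?case by (rule kcategory.axioms(1)[OF D])
  next
    case (2 F G)
    then show ?case by (simp add: functor_Hom_module)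
  next
    case (3 F)
    then have F: "klinear_functor K C D F" by simp
    note [simp] = klinear_functor_simps[OF F]
    show ?case by (auto intro!: nat_transI)
  next
    case (4 F G H \<theta>)
    then have F: "klinear_functor K C D F" and G: "klinear_functor K C D G"
      and H: "klinear_functor K C D H" by simp_all
    note [simp] = klinear_functor_simps[OF F] klinear_functor_simps[OF G]
      klinear_functor_simps[OF H]
    show ?case
    proof (rule linear_mapsI, goal_cases)
      case (1 \<eta>)
      then show ?case using comp[of F G H \<eta> \<theta>] 4 by simp
    qed (use 4 in \<open>auto simp: kcategory_linear[OF D] fun_eq_iff\<close>)
  next
    case (5 F G H \<eta>)
    then have F: "klinear_functor K C D F" and G: "klinear_functor K C D G"
      and H: "klinear_functor K C D H" by simp_all
    note [simp] = klinear_functor_simps[OF F] klinear_functor_simps[OF G]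
      klinear_functor_simps[OF H]
    show ?case
    proof (rule linear_mapsI, goal_cases)
      case (1 \<theta>)
      then show ?case using comp[of F G H \<eta> \<theta>] 5 by simp
    qed (use 5 in \<open>auto simp: kcategory_linear[OF D] fun_eq_iff\<close>)
  next
    case (6 E F G H \<eta> \<theta> \<zeta>)
    then have E: "klinear_functor K C D E" and F: "klinear_functor K C D F"
      and G: "klinear_functor K C D G" and H: "klinear_functor K C D H" by simp_all
    note [simp] = klinear_functor_simps[OF E] klinear_functor_simps[OF F]
      klinear_functor_simps[OF G] klinear_functor_simps[OF H]
    show ?case using 6 by (auto simp: kcategory.Comp_assoc[OF D] fun_eq_iff)
  next
    case (7 F G \<eta>)
    then have F: "klinear_functor K C D F" and G: "klinear_functor K C D G" by simp_all
    note [simp] = klinear_functor_simps[OF F] klinear_functor_simps[OF G]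
    show ?case using 7
      by (auto intro!: nat_trans_restrict_eqI[of \<eta>])
  next
    case (8 F G \<eta>)
    then have F: "klinear_functor K C D F" and G: "klinear_functor K C D G" by simp_all
    note [simp] = klinear_functor_simps[OF F] klinear_functor_simps[OF G]
    show ?case using 8
      by (auto intro!: nat_trans_restrict_eqI[of \<eta>])
  qed
qed

text \<open>Pointwise inverses of a natural family are automatically natural, so both comparison
  maps below only require an inverse at each object.\<close>

lemma functor_isoI:
  assumes "klinear_functor K C D F" "klinear_functor K C D G" "\<eta> \<in> nat_trans C D F G"
    and "\<And>x. x \<in> Ob C \<Longrightarrow> \<theta> x \<in> carrier (Hom D (on_ob G x) (on_ob F x))"
    and "\<And>x. x \<in> Ob C \<Longrightarrow> Comp D (on_ob F x) (on_ob G x) (on_ob F x) (\<theta> x) (\<eta> x) = Ident D (on_ob F x)"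
    and "\<And>x. x \<in> Ob C \<Longrightarrow> Comp D (on_ob G x) (on_ob F x) (on_ob G x) (\<eta> x) (\<theta> x) = Ident D (on_ob G x)"
  shows "iso_in (functor_cat K C D) F G \<eta>"
proof -
  note D = klinear_functorD(2)[OF assms(1)]
  note [simp] = klinear_functor_simps[OF assms(1)] klinear_functor_simps[OF assms(2)]
    kcategory_simps[OF D]
  have "restrict \<theta> (Ob C) \<in> nat_trans C D G F"
  proof (rule nat_transI, goal_cases)
    case (3 x y f)
    let ?c = "Comp D"
    \<comment> \<open>Insert \<open>\<eta> x \<theta> x = 1\<close> at the right end, move
      \<open>\<eta>\<close> across its naturality square, and cancel
      \<open>\<theta> y \<eta> y = 1\<close> at the left end.\<close>
    have "?c (on_ob G x) (on_ob G y) (on_ob F y) (\<theta> y) (on_hom G x y f) =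
      ?c (on_ob G x) (on_ob G y) (on_ob F y) (\<theta> y)
        (?c (on_ob G x) (on_ob G x) (on_ob G y) (on_hom G x y f)
          (?c (on_ob G x) (on_ob F x) (on_ob G x) (\<eta> x) (\<theta> x)))"
      using 3 assms(4,6) by simp
    also have "\<dots> = ?c (on_ob G x) (on_ob G y) (on_ob F y) (\<theta> y)
        (?c (on_ob G x) (on_ob F x) (on_ob G y)
          (?c (on_ob F x) (on_ob G x) (on_ob G y) (on_hom G x y f) (\<eta> x)) (\<theta> x))"
      using 3 assms(3,4) by (simp add: kcategory.Comp_assoc[OF D])
    also have "\<dots> = ?c (on_ob G x) (on_ob G y) (on_ob F y) (\<theta> y)
        (?c (on_ob G x) (on_ob F x) (on_ob G y)
          (?c (on_ob F x) (on_ob F y) (on_ob G y) (\<eta> y) (on_hom F x y f)) (\<theta> x))"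
      using 3 assms(3) by (simp add: nat_trans_naturality)
    also have "\<dots> = ?c (on_ob G x) (on_ob F y) (on_ob F y)
        (?c (on_ob F y) (on_ob G y) (on_ob F y) (\<theta> y) (\<eta> y))
        (?c (on_ob G x) (on_ob F x) (on_ob F y) (on_hom F x y f) (\<theta> x))"
      using 3 assms(3,4) by (simp add: kcategory.Comp_assoc[OF D] del: kcategory.Comp_Ident_left[OF D])
    also have "\<dots> = ?c (on_ob G x) (on_ob F x) (on_ob F y) (on_hom F x y f) (\<theta> x)"
      using 3 assms(4,5) by simp
    finally show ?case using 3 by simp
  qed (use assms(4) in auto)
  then show ?thesis unfolding iso_in_def using assms(3,5,6)
    by (auto simp: fun_eq_iff intro!: bexI[of _ "restrict \<theta> (Ob C)"])
qed

section \<open>Finite powers of objects\<close>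

text \<open>These are the equations of an n-fold biproduct. In a linear category they encode the
  universal properties of product and coproduct at once, and both are derived from them below by
  bilinearity alone. The power is a chosen function of \<open>V\<close>, so that taking powers is a
  functor.\<close>

locale finite_powers = kcategory K D
  for K :: "('k, 'r) ring_scheme" and D :: "('p, 'q, 'k) kcat" +
  fixes n :: nat and P :: "'p \<Rightarrow> 'p" and inj pr :: "'p \<Rightarrow> nat \<Rightarrow> 'q"
  assumes P_closed [simp]: "V \<in> Ob D \<Longrightarrow> P V \<in> Ob D"
    and inj_closed [simp]: "\<lbrakk>V \<in> Ob D; i < n\<rbrakk> \<Longrightarrow> inj V i \<in> carrier (Hom D V (P V))"
    and pr_closed [simp]: "\<lbrakk>V \<in> Ob D; i < n\<rbrakk> \<Longrightarrow> pr V i \<in> carrier (Hom D (P V) V)"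
    and pr_inj: "\<lbrakk>V \<in> Ob D; i < n; j < n\<rbrakk> \<Longrightarrow>
      Comp D V (P V) V (pr V i) (inj V j) = (if i = j then Ident D V else \<zero>\<^bsub>Hom D V V\<^esub>)"
    and sum_inj_pr: "V \<in> Ob D \<Longrightarrow>
      (\<Oplus>\<^bsub>Hom D (P V) (P V)\<^esub>i\<in>{..<n}. Comp D (P V) V (P V) (inj V i) (pr V i)) = Ident D (P V)"
begin

text \<open>The map into the product with prescribed coordinates; \<open>cotuple\<close> is the dual
  map out of the coproduct. The sums are explicit formulas for what the universal properties
  provide.\<close>

definition tuple :: "'p \<Rightarrow> 'p \<Rightarrow> (nat \<Rightarrow> 'q) \<Rightarrow> 'q" where
  "tuple X V f = (\<Oplus>\<^bsub>Hom D X (P V)\<^esub>i\<in>{..<n}. Comp D X V (P V) (inj V i) (f i))"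

definition cotuple :: "'p \<Rightarrow> 'p \<Rightarrow> (nat \<Rightarrow> 'q) \<Rightarrow> 'q" where
  "cotuple V X f = (\<Oplus>\<^bsub>Hom D (P V) X\<^esub>i\<in>{..<n}. Comp D (P V) V X (f i) (pr V i))"

lemma tuple_closed [simp]:
  "\<lbrakk>X \<in> Ob D; V \<in> Ob D; f \<in> {..<n} \<rightarrow> carrier (Hom D X V)\<rbrakk>
    \<Longrightarrow> tuple X V f \<in> carrier (Hom D X (P V))"
  by (simp add: tuple_def Pi_iff)

lemma cotuple_closed [simp]:
  "\<lbrakk>X \<in> Ob D; V \<in> Ob D; f \<in> {..<n} \<rightarrow> carrier (Hom D V X)\<rbrakk>
    \<Longrightarrow> cotuple V X f \<in> carrier (Hom D (P V) X)"
  by (simp add: cotuple_def Pi_iff)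

lemma pr_tuple:
  assumes [simp]: "X \<in> Ob D" "V \<in> Ob D" "i < n" and f: "f \<in> {..<n} \<rightarrow> carrier (Hom D X V)"
  shows "Comp D X (P V) V (pr V i) (tuple X V f) = f i"
proof -
  have "Comp D X (P V) V (pr V i) (tuple X V f) =
      (\<Oplus>\<^bsub>Hom D X V\<^esub>j\<in>{..<n}. Comp D X V V (Comp D V (P V) V (pr V i) (inj V j)) (f j))"
    using f by (simp add: tuple_def Comp_finsum_right Comp_assoc Pi_iff)
  also have "\<dots> = (\<Oplus>\<^bsub>Hom D X V\<^esub>j\<in>{..<n}. if j = i then f j else \<zero>\<^bsub>Hom D X V\<^esub>)"
    using f by (simp add: pr_inj if_distrib[of "\<lambda>h. Comp D _ _ _ h _"]
        if_distrib[of "Comp D _ _ _ _"] Pi_iff eq_commute[of i] cong: if_cong)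
  also have "\<dots> = f i" using f by (intro Hom_finsum_delta) auto
  finally show ?thesis .
qed

lemma cotuple_inj:
  assumes [simp]: "X \<in> Ob D" "V \<in> Ob D" "i < n" and f: "f \<in> {..<n} \<rightarrow> carrier (Hom D V X)"
  shows "Comp D V (P V) X (cotuple V X f) (inj V i) = f i"
proof -
  have "Comp D V (P V) X (cotuple V X f) (inj V i) =
      (\<Oplus>\<^bsub>Hom D V X\<^esub>j\<in>{..<n}. Comp D V V X (f j) (Comp D V (P V) V (pr V j) (inj V i)))"
    using f by (simp add: cotuple_def Comp_finsum_left Comp_assoc Pi_iff)
  also have "\<dots> = (\<Oplus>\<^bsub>Hom D V X\<^esub>j\<in>{..<n}. if j = i then f j else \<zero>\<^bsub>Hom D V X\<^esub>)"
    using f by (simp add: pr_inj if_distrib[of "\<lambda>h. Comp D _ _ _ h _"]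
        if_distrib[of "Comp D _ _ _ _"] Pi_iff eq_commute[of i] cong: if_cong)
  also have "\<dots> = f i" using f by (intro Hom_finsum_delta) auto
  finally show ?thesis .
qed

lemma tuple_pr:
  assumes [simp]: "X \<in> Ob D" "V \<in> Ob D" and f: "f \<in> carrier (Hom D X (P V))"
  shows "tuple X V (\<lambda>i. Comp D X (P V) V (pr V i) f) = f"
proof -
  have "tuple X V (\<lambda>i. Comp D X (P V) V (pr V i) f) = Comp D X (P V) (P V)
      (\<Oplus>\<^bsub>Hom D (P V) (P V)\<^esub>i\<in>{..<n}. Comp D (P V) V (P V) (inj V i) (pr V i)) f"
    using f by (simp add: tuple_def Comp_finsum_left Comp_assoc Pi_iff)
  then show ?thesis using f by (simp add: sum_inj_pr)
qed

lemma cotuple_eta: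
  assumes [simp]: "X \<in> Ob D" "V \<in> Ob D" and f: "f \<in> carrier (Hom D (P V) X)"
  shows "cotuple V X (\<lambda>i. Comp D V (P V) X f (inj V i)) = f"
proof -
  have "cotuple V X (\<lambda>i. Comp D V (P V) X f (inj V i)) = Comp D (P V) (P V) X f
      (\<Oplus>\<^bsub>Hom D (P V) (P V)\<^esub>i\<in>{..<n}. Comp D (P V) V (P V) (inj V i) (pr V i))"
    using f by (simp add: cotuple_def Comp_finsum_right Comp_assoc Pi_iff)
  then show ?thesis using f by (simp add: sum_inj_pr)
qed

text \<open>By \<open>tuple_pr\<close> a map into a power is rebuilt from its coordinates; this is
  the uniqueness half of the product property.\<close>

lemma pr_ext:
  assumes "X \<in> Ob D" "V \<in> Ob D" "f \<in> carrier (Hom D X (P V))" "g \<in> carrier (Hom D X (P V))"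
    and "\<And>i. i < n \<Longrightarrow> Comp D X (P V) V (pr V i) f = Comp D X (P V) V (pr V i) g"
  shows "f = g"
proof -
  have "f = tuple X V (\<lambda>i. Comp D X (P V) V (pr V i) f)" using assms by (simp add: tuple_pr)
  also have "\<dots> = tuple X V (\<lambda>i. Comp D X (P V) V (pr V i) g)"
    unfolding tuple_def using assms(5) by (intro finsum_cong_index) auto
  also have "\<dots> = g" using assms by (simp add: tuple_pr)
  finally show ?thesis .
qed

lemma inj_ext:
  assumes "X \<in> Ob D" "V \<in> Ob D" "f \<in> carrier (Hom D (P V) X)" "g \<in> carrier (Hom D (P V) X)"
    and "\<And>i. i < n \<Longrightarrow> Comp D V (P V) X f (inj V i) = Comp D V (P V) X g (inj V i)"
  shows "f = g"
proof -
  have "f = cotuple V X (\<lambda>i. Comp D V (P V) X f (inj V i))" using assms by (simp add: cotuple_eta)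
  also have "\<dots> = cotuple V X (\<lambda>i. Comp D V (P V) X g (inj V i))"
    unfolding cotuple_def using assms(5) by (intro finsum_cong_index) auto
  also have "\<dots> = g" using assms by (simp add: cotuple_eta)
  finally show ?thesis .
qed

text \<open>A map between powers is determined by its matrix of entries. This is the test that
  reduces identities between block maps to identities between entries.\<close>

lemma pr_inj_ext:
  assumes "V \<in> Ob D" "W \<in> Ob D" "f \<in> carrier (Hom D (P V) (P W))" "g \<in> carrier (Hom D (P V) (P W))"
    and "\<And>i j. \<lbrakk>i < n; j < n\<rbrakk> \<Longrightarrow>
      Comp D V (P W) W (pr W i) (Comp D V (P V) (P W) f (inj V j)) =
      Comp D V (P W) W (pr W i) (Comp D V (P V) (P W) g (inj V j))"
  shows "f = g"
proof (rule inj_ext[of "P W" V f g])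
  fix j
  assume "j < n"
  show "Comp D V (P V) (P W) f (inj V j) = Comp D V (P V) (P W) g (inj V j)"
    by (rule pr_ext[of V W]) (use assms \<open>j < n\<close> in simp_all)
qed (use assms in simp_all)

text \<open>Row times column: this is where the sum in the matrix product arises from composition of
  maps between powers.\<close>

lemma cotuple_tuple:
  assumes [simp]: "X \<in> Ob D" "V \<in> Ob D" "Y \<in> Ob D"
    and fg: "f \<in> {..<n} \<rightarrow> carrier (Hom D V Y)" "g \<in> {..<n} \<rightarrow> carrier (Hom D X V)"
  shows "Comp D X (P V) Y (cotuple V Y f) (tuple X V g) =
    (\<Oplus>\<^bsub>Hom D X Y\<^esub>i\<in>{..<n}. Comp D X V Y (f i) (g i))"
proof -
  have "Comp D X (P V) Y (cotuple V Y f) (tuple X V g) =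
      (\<Oplus>\<^bsub>Hom D X Y\<^esub>i\<in>{..<n}. Comp D X V Y (f i) (Comp D X (P V) V (pr V i) (tuple X V g)))"
    using fg unfolding cotuple_def by (simp add: Comp_finsum_left Comp_assoc Pi_iff)
  then show ?thesis using fg by (simp add: pr_tuple)
qed

text \<open>Rows belong to the target and columns to the source, as for matrices acting on column
  vectors; with this convention composition of maps matches the matrix product in its usual
  order.\<close>

definition block :: "'p \<Rightarrow> 'p \<Rightarrow> 'q mat \<Rightarrow> 'q" where
  "block V W A = tuple (P V) W (\<lambda>i. cotuple V W (\<lambda>j. A $$ (i, j)))"

definition block_functor :: "('p, 'q mat, 'p, 'q) kfun" where
  "block_functor = \<lparr>on_ob = P, on_hom = block\<rparr>"

context
  fixes V W assumes V [simp]: "V \<in> Ob D" and W [simp]: "W \<in> Ob D"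
begin

lemma block_closed [simp]:
  "A \<in> carrier (Hom (matrix_cat n D) V W) \<Longrightarrow> block V W A \<in> carrier (Hom D (P V) (P W))"
  by (simp add: block_def Pi_iff)

lemma pr_block:
  "\<lbrakk>A \<in> carrier (Hom (matrix_cat n D) V W); i < n\<rbrakk> \<Longrightarrow>
    Comp D (P V) (P W) W (pr W i) (block V W A) = cotuple V W (\<lambda>j. A $$ (i, j))"
  by (simp add: block_def pr_tuple Pi_iff)

lemma pr_block_inj:
  assumes "A \<in> carrier (Hom (matrix_cat n D) V W)" "i < n" "j < n"
  shows "Comp D V (P W) W (pr W i) (Comp D V (P V) (P W) (block V W A) (inj V j)) = A $$ (i, j)"
proof -
  have "Comp D V (P W) W (pr W i) (Comp D V (P V) (P W) (block V W A) (inj V j)) =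
      Comp D V (P V) W (Comp D (P V) (P W) W (pr W i) (block V W A)) (inj V j)"
    using assms block_closed[OF assms(1)] by (simp add: Comp_assoc)
  also have "\<dots> = A $$ (i, j)" using assms by (simp add: pr_block cotuple_inj Pi_iff)
  finally show ?thesis .
qed

lemma block_inj:
  assumes "A \<in> carrier (Hom (matrix_cat n D) V W)" "j < n"
  shows "Comp D V (P V) (P W) (block V W A) (inj V j) = tuple V W (\<lambda>i. A $$ (i, j))"
  by (rule pr_ext[of V W])
    (use assms block_closed[OF assms(1)] in \<open>simp_all add: pr_block_inj pr_tuple Pi_iff\<close>)

end

lemma klinear_functor_block: "klinear_functor K (matrix_cat n D) D block_functor"
proof (intro klinear_functor.intro klinear_functor_axioms.intro, goal_cases)
  case 1
  show ?case by (rule matrix_kcategory)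
next
  case 2
  show ?case by (rule kcategory_axioms)
next
  case (3 V)
  then show ?case by (simp add: block_functor_def)
next
  case (4 V W)
  then have [simp]: "V \<in> Ob D" "W \<in> Ob D" by simp_all
  have "block V W \<in> linear_maps K (Hom (matrix_cat n D) V W) (Hom D (P V) (P W))"
  proof (rule linear_mapsI, goal_cases)
    case (1 A)
    then show ?case by (rule block_closed[rotated 2]) simp_all
  next
    case (2 A B)
    \<comment> \<open>The matrix is named to keep it opaque: only its membership and its entries are
      used, and its defining expression is not unfolded inside \<open>block\<close>.\<close>
    define M where "M = A \<oplus>\<^bsub>Hom (matrix_cat n D) V W\<^esub> B"
    have M: "M \<in> carrier (Hom (matrix_cat n D) V W)"
      and M_index: "\<And>i j. \<lbrakk>i < n; j < n\<rbrakk> \<Longrightarrow> M $$ (i, j) = A $$ (i, j) \<oplus>\<^bsub>Hom D V W\<^esub> B $$ (i, j)"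
      using 2 by (simp_all add: M_def)
    have "block V W M = block V W A \<oplus>\<^bsub>Hom D (P V) (P W)\<^esub> block V W B"
      by (rule pr_inj_ext[of V W])
        (use M 2 in \<open>simp_all add: Comp_add_left Comp_add_right pr_block_inj M_index\<close>)
    then show ?case by (simp only: M_def)
  next
    case (3 a A)
    define M where "M = a \<odot>\<^bsub>Hom (matrix_cat n D) V W\<^esub> A"
    have M: "M \<in> carrier (Hom (matrix_cat n D) V W)"
      and M_index: "\<And>i j. \<lbrakk>i < n; j < n\<rbrakk> \<Longrightarrow> M $$ (i, j) = a \<odot>\<^bsub>Hom D V W\<^esub> A $$ (i, j)"
      using 3 by (simp_all add: M_def)
    have "block V W M = a \<odot>\<^bsub>Hom D (P V) (P W)\<^esub> block V W A"
      by (rule pr_inj_ext[of V W])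
        (use M 3 in \<open>simp_all add: Comp_smult_left Comp_smult_right pr_block_inj M_index\<close>)
    then show ?case by (simp only: M_def)
  qed
  then show ?case by (simp add: block_functor_def)
next
  case (5 U V W A B)
  then have [simp]: "U \<in> Ob D" "V \<in> Ob D" "W \<in> Ob D" by simp_all
  define M where "M = Comp (matrix_cat n D) U V W B A"
  have M: "M \<in> carrier (Hom (matrix_cat n D) U W)"
    and M_index: "\<And>i j. \<lbrakk>i < n; j < n\<rbrakk> \<Longrightarrow>
      M $$ (i, j) = (\<Oplus>\<^bsub>Hom D U W\<^esub>l\<in>{..<n}. Comp D U V W (B $$ (i, l)) (A $$ (l, j)))"
    using 5 by (simp_all add: M_def Pi_iff)
  have "block U W M = Comp D (P U) (P V) (P W) (block V W B) (block U V A)"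
  proof (rule pr_inj_ext[of U W])
    fix i j
    assume ij: "i < n" "j < n"
    \<comment> \<open>Reassociate so that row \<open>i\<close> of \<open>B\<close> meets column
      \<open>j\<close> of \<open>A\<close>.\<close>
    have "Comp D U (P W) W (pr W i) (Comp D U (P U) (P W)
          (Comp D (P U) (P V) (P W) (block V W B) (block U V A)) (inj U j)) =
        Comp D U (P V) W (Comp D (P V) (P W) W (pr W i) (block V W B))
          (Comp D U (P U) (P V) (block U V A) (inj U j))"
      using 5 ij by (simp add: Comp_assoc)
    also have "\<dots> = (\<Oplus>\<^bsub>Hom D U W\<^esub>l\<in>{..<n}. Comp D U V W (B $$ (i, l)) (A $$ (l, j)))"
      using 5 ij by (simp add: pr_block block_inj cotuple_tuple Pi_iff)
    also have "\<dots> = Comp D U (P W) W (pr W i) (Comp D U (P U) (P W) (block U W M) (inj U j))"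
      using M ij by (simp add: pr_block_inj M_index)
    finally show "Comp D U (P W) W (pr W i) (Comp D U (P U) (P W) (block U W M) (inj U j)) =
        Comp D U (P W) W (pr W i) (Comp D U (P U) (P W)
          (Comp D (P U) (P V) (P W) (block V W B) (block U V A)) (inj U j))"
      by (rule sym)
  qed (use M 5 in simp_all)
  then show ?case by (simp add: block_functor_def M_def)
next
  case (6 V)
  then have [simp]: "V \<in> Ob D" by simp
  define M where "M = Ident (matrix_cat n D) V"
  have M: "M \<in> carrier (Hom (matrix_cat n D) V V)"
    and M_index: "\<And>i j. \<lbrakk>i < n; j < n\<rbrakk> \<Longrightarrow>
      M $$ (i, j) = (if i = j then Ident D V else \<zero>\<^bsub>Hom D V V\<^esub>)"
    by (simp_all add: M_def)
  have "block V V M = Ident D (P V)"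
    by (rule pr_inj_ext[of V V]) (use M in \<open>simp_all add: pr_block_inj pr_inj M_index\<close>)
  then show ?case by (simp add: block_functor_def M_def)
qed

text \<open>The form of \<open>pr_inj\<close> that still matches once composites are nested to the
  right.\<close>

lemma pr_inj_assoc:
  "\<lbrakk>V \<in> Ob D; X \<in> Ob D; i < n; j < n; h \<in> carrier (Hom D X V)\<rbrakk> \<Longrightarrow>
    Comp D X (P V) V (pr V i) (Comp D X V (P V) (inj V j) h) =
    (if i = j then h else \<zero>\<^bsub>Hom D X V\<^esub>)"
  by (simp add: Comp_assoc[symmetric] pr_inj)

text \<open>The n-fold power of \<open>f\<close>, that is, the block map of the scalar matrix with
  \<open>f\<close> on the diagonal. Defining it by coordinates avoids sums with zero
  entries.\<close>

definition diag :: "'p \<Rightarrow> 'p \<Rightarrow> 'q \<Rightarrow> 'q" where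
  "diag V W f = tuple (P V) W (\<lambda>i. Comp D (P V) V W f (pr V i))"

context
  fixes V W f
  assumes V [simp]: "V \<in> Ob D" and W [simp]: "W \<in> Ob D" and f [simp]: "f \<in> carrier (Hom D V W)"
begin

lemma diag_closed [simp]: "diag V W f \<in> carrier (Hom D (P V) (P W))"
  by (simp add: diag_def Pi_iff)

lemma pr_diag: "i < n \<Longrightarrow> Comp D (P V) (P W) W (pr W i) (diag V W f) = Comp D (P V) V W f (pr V i)"
  by (simp add: diag_def pr_tuple Pi_iff)

lemma pr_diag_assoc:
  "\<lbrakk>i < n; X \<in> Ob D; h \<in> carrier (Hom D X (P V))\<rbrakk> \<Longrightarrow>
    Comp D X (P W) W (pr W i) (Comp D X (P V) (P W) (diag V W f) h) =
    Comp D X V W f (Comp D X (P V) V (pr V i) h)"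
  using pr_diag[of i] Comp_assoc[of X "P V" "P W" W h "diag V W f" "pr W i"]
  by (simp add: Comp_assoc)

lemma diag_inj:
  assumes "j < n"
  shows "Comp D V (P V) (P W) (diag V W f) (inj V j) = Comp D V W (P W) (inj W j) f"
proof (rule pr_ext[of V W])
  fix i
  assume "i < n"
  then show "Comp D V (P W) W (pr W i) (Comp D V (P V) (P W) (diag V W f) (inj V j)) =
      Comp D V (P W) W (pr W i) (Comp D V W (P W) (inj W j) f)"
    using assms by (simp add: pr_diag_assoc pr_inj pr_inj_assoc)
qed (use assms in simp_all)

end

lemma diag_add:
  assumes "V \<in> Ob D" "W \<in> Ob D" "f \<in> carrier (Hom D V W)" "g \<in> carrier (Hom D V W)"
  shows "diag V W (f \<oplus>\<^bsub>Hom D V W\<^esub> g) = diag V W f \<oplus>\<^bsub>Hom D (P V) (P W)\<^esub> diag V W g"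
  by (rule pr_ext[of "P V" W]) (use assms in \<open>simp_all add: pr_diag Comp_add_left Comp_add_right\<close>)

lemma diag_smult:
  assumes "V \<in> Ob D" "W \<in> Ob D" "f \<in> carrier (Hom D V W)" "a \<in> carrier K"
  shows "diag V W (a \<odot>\<^bsub>Hom D V W\<^esub> f) = a \<odot>\<^bsub>Hom D (P V) (P W)\<^esub> diag V W f"
  by (rule pr_ext[of "P V" W])
    (use assms in \<open>simp_all add: pr_diag Comp_smult_left Comp_smult_right\<close>)

lemma diag_Comp:
  assumes "U \<in> Ob D" "V \<in> Ob D" "W \<in> Ob D" "f \<in> carrier (Hom D U V)" "g \<in> carrier (Hom D V W)"
  shows "diag U W (Comp D U V W g f) = Comp D (P U) (P V) (P W) (diag V W g) (diag U V f)"
  by (rule pr_ext[of "P U" W]) (use assms in \<open>simp_all add: pr_diag pr_diag_assoc Comp_assoc\<close>)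

lemma diag_Ident:
  assumes "V \<in> Ob D"
  shows "diag V V (Ident D V) = Ident D (P V)"
  by (rule pr_ext[of "P V" V]) (use assms in \<open>simp_all add: pr_diag\<close>)

end

section \<open>Entrywise functors and elementary matrices\<close>

definition matrix_functor :: "nat \<Rightarrow> ('o, 'm, 'p, 'q) kfun \<Rightarrow> ('o, 'm mat, 'p, 'q mat) kfun" where
  "matrix_functor n F =
    \<lparr>on_ob = on_ob F, on_hom = (\<lambda>x y A. mat n n (\<lambda>ij. on_hom F x y (A $$ ij)))\<rparr>"

lemma matrix_functor_simps [simp]:
  "on_ob (matrix_functor n F) x = on_ob F x"
  "on_hom (matrix_functor n F) x y A = mat n n (\<lambda>ij. on_hom F x y (A $$ ij))"
  by (simp_all add: matrix_functor_def)

text \<open>An entry of a matrix product is a finite sum of composites, and a linear functor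
  preserves both sums and composites.\<close>

lemma klinear_functor_matrix:
  assumes "klinear_functor K C D F"
  shows "klinear_functor K (matrix_cat n C) (matrix_cat n D) (matrix_functor n F)"
proof -
  note CD = klinear_functorD[OF assms]
  note [simp] = klinear_functor_simps[OF assms] kcategory_simps[OF CD(1)] kcategory_simps[OF CD(2)]
  note F_simps = klinear_functor.on_hom_finsum[OF assms] klinear_functor.on_hom_Comp[OF assms]
  show ?thesis
  proof (intro klinear_functor.intro klinear_functor_axioms.intro, goal_cases)
    case 1
    show ?case by (rule kcategory.matrix_kcategory[OF CD(1)])
  next
    case 2
    show ?case by (rule kcategory.matrix_kcategory[OF CD(2)])
  next
    case (3 x)
    then show ?case by simp
  next
    case (4 x y)
    then show ?case
      by (intro linear_mapsI)
        (auto intro!: eq_matI simp: klinear_functor_linear[OF assms])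
  next
    case (5 x y z A B)
    show ?case
    proof (rule eq_matI, goal_cases)
      case (1 i j)
      then have "i < n" "j < n" by simp_all
      then show ?case using 5 by (simp add: F_simps Pi_iff)
    qed simp_all
  next
    case (6 x)
    show ?case
    proof (rule eq_matI, goal_cases)
      case (1 i j)
      then have "i < n" "j < n" by simp_all
      then show ?case using 6 by simp
    qed simp_all
  qed
qed

text \<open>The matrix \<open>f E_ij\<close>, where \<open>f\<close> may go between different
  objects; the matrix units proper are those with \<open>f\<close> an identity. Indices out of range
  give the zero matrix, so closure has no premise on them.\<close>

definition elem_mat :: "nat \<Rightarrow> ('o, 'm, 'k) kcat \<Rightarrow> 'o \<Rightarrow> 'o \<Rightarrow> nat \<Rightarrow> nat \<Rightarrow> 'm \<Rightarrow> 'm mat" where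
  "elem_mat n C x y i j f =
    mat n n (\<lambda>(a, b). if a = i \<and> b = j then f else \<zero>\<^bsub>Hom C x y\<^esub>)"

context kcategory
begin

lemma elem_mat_closed:
  "\<lbrakk>x \<in> Ob C; y \<in> Ob C; f \<in> carrier (Hom C x y)\<rbrakk>
    \<Longrightarrow> elem_mat n C x y i j f \<in> carrier (Hom (matrix_cat n C) x y)"
  by (simp add: elem_mat_def)

lemma elem_mat_linear:
  assumes "x \<in> Ob C" "y \<in> Ob C"
  shows "elem_mat n C x y i j \<in> linear_maps K (Hom C x y) (Hom (matrix_cat n C) x y)"
  by (rule linear_mapsI) (use assms in \<open>simp_all add: elem_mat_def, (intro eq_matI; simp)+\<close>)

text \<open>Only the summand at \<open>m = j\<close> can be nonzero. The bounds matter: for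
  \<open>j = j'\<close> out of range the factors vanish while the right side need not.\<close>

lemma elem_mat_Comp:
  assumes [simp]: "x \<in> Ob C" "y \<in> Ob C" "z \<in> Ob C"
    and fg [simp]: "f \<in> carrier (Hom C x y)" "g \<in> carrier (Hom C y z)" and "j < n" "j' < n"
  shows "Comp (matrix_cat n C) x y z (elem_mat n C y z i j g) (elem_mat n C x y j' l f) =
    (if j = j' then elem_mat n C x z i l (Comp C x y z g f)
     else \<zero>\<^bsub>Hom (matrix_cat n C) x z\<^esub>)"
proof (rule eq_matI, goal_cases)
  case (1 a b)
  then have [simp]: "a < n" "b < n" by (simp_all add: elem_mat_def split: if_splits)
  have "(\<Oplus>\<^bsub>Hom C x z\<^esub>m\<in>{..<n}. Comp C x y z (elem_mat n C y z i j g $$ (a, m))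
        (elem_mat n C x y j' l f $$ (m, b))) =
      (\<Oplus>\<^bsub>Hom C x z\<^esub>m\<in>{..<n}. if m = j then
        (if a = i \<and> b = l \<and> j = j' then Comp C x y z g f else \<zero>\<^bsub>Hom C x z\<^esub>) else \<zero>\<^bsub>Hom C x z\<^esub>)"
    by (rule finsum_cong_index) (simp_all add: elem_mat_def)
  also have "\<dots> = (if a = i \<and> b = l \<and> j = j' then Comp C x y z g f else \<zero>\<^bsub>Hom C x z\<^esub>)"
    using \<open>j < n\<close> by (intro Hom_finsum_delta) simp_all
  finally show ?case by (cases "j = j'") (simp_all add: elem_mat_def)
qed (simp_all add: elem_mat_def)

text \<open>Reading off an entry is a linear map on the matrix space, hence commutes with finite
  sums.\<close>

lemma matrix_finsum_index:
  assumes "x \<in> Ob C" "y \<in> Ob C" "finite I" "A \<in> I \<rightarrow> carrier (Hom (matrix_cat n C) x y)"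
    and "i < n" "j < n"
  shows "(\<Oplus>\<^bsub>Hom (matrix_cat n C) x y\<^esub>l\<in>I. A l) $$ (i, j) = (\<Oplus>\<^bsub>Hom C x y\<^esub>l\<in>I. A l $$ (i, j))"
proof -
  have "(\<lambda>M. M $$ (i, j)) \<in> linear_maps K (Hom (matrix_cat n C) x y) (Hom C x y)"
    using assms by (intro linear_mapsI) simp_all
  from linear_maps_finsum[OF this matrix_Hom_module Hom_module, OF assms(1,2,1,2,3,4)]
  show ?thesis .
qed

text \<open>With \<open>E_ii = E_i0 E_0i\<close> this is the fullness of the corner idempotent, used
  in \<open>power_corner_iso\<close> to rebuild a module from its corner.\<close>

lemma sum_elem_mat_Ident:
  assumes [simp]: "x \<in> Ob C"
  shows "(\<Oplus>\<^bsub>Hom (matrix_cat n C) x x\<^esub>i\<in>{..<n}. elem_mat n C x x i i (Ident C x)) =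
    Ident (matrix_cat n C) x"
proof -
  let ?M = "\<Oplus>\<^bsub>Hom (matrix_cat n C) x x\<^esub>i\<in>{..<n}. elem_mat n C x x i i (Ident C x)"
  have closed: "(\<lambda>i. elem_mat n C x x i i (Ident C x)) \<in> {..<n} \<rightarrow> carrier (Hom (matrix_cat n C) x x)"
    by (intro Pi_I elem_mat_closed) simp_all
  \<comment> \<open>The sum is not of the form \<open>mat n n\<close>, so its dimensions have to be
    obtained from membership in the hom space.\<close>
  have M: "?M \<in> carrier_mat n n"
    using kcategory.Hom_finsum_closed[OF matrix_kcategory _ _ closed] by simp
  show ?thesis
  proof (rule eq_matI, goal_cases)
    case (1 a b)
    then have [simp]: "a < n" "b < n" by simp_all
    have "?M $$ (a, b) = (\<Oplus>\<^bsub>Hom C x x\<^esub>i\<in>{..<n}. elem_mat n C x x i i (Ident C x) $$ (a, b))"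
      by (rule matrix_finsum_index[OF _ _ _ closed]) simp_all
    also have "\<dots> = (\<Oplus>\<^bsub>Hom C x x\<^esub>i\<in>{..<n}. if i = a then
        (if a = b then Ident C x else \<zero>\<^bsub>Hom C x x\<^esub>) else \<zero>\<^bsub>Hom C x x\<^esub>)"
      by (rule finsum_cong_index) (simp_all add: elem_mat_def)
    also have "\<dots> = (if a = b then Ident C x else \<zero>\<^bsub>Hom C x x\<^esub>)"
      by (intro Hom_finsum_delta) simp_all
    finally show ?case by simp
  qed (use carrier_matD[OF M] in simp_all)
qed

text \<open>Right multiplication by \<open>E_jl\<close> moves column \<open>j\<close> to column
  \<open>l\<close>. With \<open>l = 0\<close> this yields the naturality of the comparison map in
  \<open>power_corner_iso\<close>.\<close>

lemma Comp_elem_mat_column: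
  assumes [simp]: "x \<in> Ob C" "y \<in> Ob C" and A: "A \<in> carrier (Hom (matrix_cat n C) x y)" and "j < n"
  shows "Comp (matrix_cat n C) x x y A (elem_mat n C x x j l (Ident C x)) =
    (\<Oplus>\<^bsub>Hom (matrix_cat n C) x y\<^esub>i\<in>{..<n}. elem_mat n C x y i l (A $$ (i, j)))"
proof -
  let ?M = "\<Oplus>\<^bsub>Hom (matrix_cat n C) x y\<^esub>i\<in>{..<n}. elem_mat n C x y i l (A $$ (i, j))"
  have closed: "(\<lambda>i. elem_mat n C x y i l (A $$ (i, j))) \<in> {..<n} \<rightarrow> carrier (Hom (matrix_cat n C) x y)"
    using A \<open>j < n\<close> by (intro Pi_I elem_mat_closed) simp_all
  have M: "?M \<in> carrier_mat n n"
    using kcategory.Hom_finsum_closed[OF matrix_kcategory _ _ closed] by simp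
  show ?thesis
  proof (rule eq_matI, goal_cases)
    case (1 a b)
    then have [simp]: "a < n" "b < n" using carrier_matD[OF M] by simp_all
    have "(\<Oplus>\<^bsub>Hom C x y\<^esub>m\<in>{..<n}. Comp C x x y (A $$ (a, m))
          (elem_mat n C x x j l (Ident C x) $$ (m, b))) =
        (\<Oplus>\<^bsub>Hom C x y\<^esub>m\<in>{..<n}. if m = j then
          (if b = l then A $$ (a, m) else \<zero>\<^bsub>Hom C x y\<^esub>) else \<zero>\<^bsub>Hom C x y\<^esub>)"
      by (rule finsum_cong_index) (use A in \<open>simp_all add: elem_mat_def\<close>)
    also have "\<dots> = (if b = l then A $$ (a, j) else \<zero>\<^bsub>Hom C x y\<^esub>)"
      using A \<open>j < n\<close> by (intro Hom_finsum_delta) simp_all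
    \<comment> \<open>The value is expanded again into a sum with one nonzero term, now over the row
      index, to meet the entry of the right side.\<close>
    also have "\<dots> = (\<Oplus>\<^bsub>Hom C x y\<^esub>i\<in>{..<n}. if i = a then
          (if b = l then A $$ (i, j) else \<zero>\<^bsub>Hom C x y\<^esub>) else \<zero>\<^bsub>Hom C x y\<^esub>)"
      using A \<open>j < n\<close> by (intro Hom_finsum_delta[symmetric]) simp_all
    also have "\<dots> = (\<Oplus>\<^bsub>Hom C x y\<^esub>i\<in>{..<n}. elem_mat n C x y i l (A $$ (i, j)) $$ (a, b))"
      by (rule finsum_cong_index) (simp_all add: elem_mat_def)
    also have "\<dots> = ?M $$ (a, b)"
      by (rule matrix_finsum_index[OF _ _ _ closed, symmetric]) simp_all
    finally show ?case by simp
  qed (use carrier_matD[OF M] in simp_all)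
qed

end

section \<open>Modules over a category and over its matrix category\<close>

text \<open>\<open>S V e\<close> is a chosen image of the idempotent \<open>e\<close>, with section
  \<open>sec V e\<close> and retraction \<open>ret V e\<close>. Fixing the splittings as functions
  makes the corner of a module a definite object, so that passing to it is a functor.\<close>

locale matrix_equivalence = finite_powers K D n P inj pr
  for K :: "('k, 'r) ring_scheme" and D :: "('p, 'q, 'k) kcat" and n P inj pr +
  fixes C :: "('o, 'm, 'k) kcat" and S :: "'p \<Rightarrow> 'q \<Rightarrow> 'p" and sec ret :: "'p \<Rightarrow> 'q \<Rightarrow> 'q"
  assumes C: "kcategory K C" and n_pos [simp]: "n > 0"
    and split: "\<lbrakk>V \<in> Ob D; e \<in> carrier (Hom D V V); Comp D V V V e e = e\<rbrakk> \<Longrightarrow>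
      S V e \<in> Ob D \<and> sec V e \<in> carrier (Hom D (S V e) V) \<and> ret V e \<in> carrier (Hom D V (S V e)) \<and>
      Comp D (S V e) V (S V e) (ret V e) (sec V e) = Ident D (S V e) \<and>
      Comp D V (S V e) V (sec V e) (ret V e) = e"
begin

section \<open>From modules over \<open>C\<close> to modules over its matrix category\<close>

abbreviation MC where "MC \<equiv> matrix_cat n C"

abbreviation E where "E \<equiv> elem_mat n C"

lemmas [simp] = kcategory_simps[OF C] kcategory.elem_mat_closed[OF C]

text \<open>As a composite of the entrywise functor with the block functor, it inherits linearity
  and functoriality from the two.\<close>

definition power_module :: "('o, 'm, 'p, 'q) kfun \<Rightarrow> ('o, 'm mat, 'p, 'q) kfun" where
  "power_module M = comp_functor block_functor (matrix_functor n M)"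

lemma power_module_ob: "on_ob (power_module M) x = P (on_ob M x)"
  by (simp add: power_module_def block_functor_def)

lemma power_module_hom: "on_hom (power_module M) x y A =
    block (on_ob M x) (on_ob M y) (mat n n (\<lambda>ij. on_hom M x y (A $$ ij)))"
  by (simp add: power_module_def block_functor_def)

lemma klinear_functor_power_module:
  "klinear_functor K C D M \<Longrightarrow> klinear_functor K MC D (power_module M)"
  unfolding power_module_def
  by (rule klinear_functor_comp[OF klinear_functor_matrix klinear_functor_block])

definition power_functor ::
  "(('o, 'm, 'p, 'q) kfun, 'o \<Rightarrow> 'q, ('o, 'm mat, 'p, 'q) kfun, 'o \<Rightarrow> 'q) kfun" where
  "power_functor = \<lparr>on_ob = power_module,
     on_hom = (\<lambda>M M' \<eta>. \<lambda>x\<in>Ob C. diag (on_ob M x) (on_ob M' x) (\<eta> x))\<rparr>"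

lemma power_functor_simps [simp]:
  "on_ob power_functor M = power_module M"
  "on_hom power_functor M M' \<eta> = (\<lambda>x\<in>Ob C. diag (on_ob M x) (on_ob M' x) (\<eta> x))"
  by (simp_all add: power_functor_def)

context
  fixes M assumes M: "klinear_functor K C D M"
begin

lemmas [simp] = klinear_functor_simps[OF M]

lemma entrywise_closed:
  "\<lbrakk>x \<in> Ob C; y \<in> Ob C; A \<in> carrier (Hom MC x y)\<rbrakk> \<Longrightarrow>
    mat n n (\<lambda>ij. on_hom M x y (A $$ ij)) \<in> carrier (Hom (matrix_cat n D) (on_ob M x) (on_ob M y))"
  by simp

lemma pr_power_module_inj:
  "\<lbrakk>x \<in> Ob C; y \<in> Ob C; A \<in> carrier (Hom MC x y); i < n; j < n\<rbrakk> \<Longrightarrow>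
    Comp D (on_ob M x) (P (on_ob M y)) (on_ob M y) (pr (on_ob M y) i)
      (Comp D (on_ob M x) (P (on_ob M x)) (P (on_ob M y)) (on_hom (power_module M) x y A)
        (inj (on_ob M x) j)) = on_hom M x y (A $$ (i, j))"
  unfolding power_module_hom by (subst pr_block_inj[OF _ _ entrywise_closed]) simp_all

lemma power_module_inj:
  "\<lbrakk>x \<in> Ob C; y \<in> Ob C; A \<in> carrier (Hom MC x y); j < n\<rbrakk> \<Longrightarrow>
    Comp D (on_ob M x) (P (on_ob M x)) (P (on_ob M y)) (on_hom (power_module M) x y A)
        (inj (on_ob M x) j) = tuple (on_ob M x) (on_ob M y) (\<lambda>i. on_hom M x y (A $$ (i, j)))"
  unfolding power_module_hom tuple_def by (subst block_inj[OF _ _ entrywise_closed]) (simp_all add: tuple_def)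

lemma power_module_closed:
  "\<lbrakk>x \<in> Ob C; y \<in> Ob C; A \<in> carrier (Hom MC x y)\<rbrakk> \<Longrightarrow>
    on_hom (power_module M) x y A \<in> carrier (Hom D (P (on_ob M x)) (P (on_ob M y)))"
  unfolding power_module_hom by (rule block_closed[OF _ _ entrywise_closed]) simp_all

text \<open>A block matrix with a single entry reads coordinate \<open>j\<close>, applies
  \<open>f\<close> and writes coordinate \<open>i\<close>. For \<open>i = j = 0\<close> and
  \<open>f\<close> an identity, the corner idempotent becomes \<open>inj 0\<close> after
  \<open>pr 0\<close>, which is already split by \<open>on_ob M x\<close>.\<close>

lemma power_module_elem_mat:
  assumes [simp]: "x \<in> Ob C" "y \<in> Ob C" "f \<in> carrier (Hom C x y)" "i < n" "j < n"
  shows "on_hom (power_module M) x y (E x y i j f) =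
    Comp D (P (on_ob M x)) (on_ob M y) (P (on_ob M y)) (inj (on_ob M y) i)
      (Comp D (P (on_ob M x)) (on_ob M x) (on_ob M y) (on_hom M x y f) (pr (on_ob M x) j))"
proof (rule pr_inj_ext[of "on_ob M x" "on_ob M y"])
  fix a b
  assume "a < n" "b < n"
  then show "Comp D (on_ob M x) (P (on_ob M y)) (on_ob M y) (pr (on_ob M y) a)
      (Comp D (on_ob M x) (P (on_ob M x)) (P (on_ob M y))
        (on_hom (power_module M) x y (E x y i j f)) (inj (on_ob M x) b)) =
    Comp D (on_ob M x) (P (on_ob M y)) (on_ob M y) (pr (on_ob M y) a)
      (Comp D (on_ob M x) (P (on_ob M x)) (P (on_ob M y))
        (Comp D (P (on_ob M x)) (on_ob M y) (P (on_ob M y)) (inj (on_ob M y) i)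
          (Comp D (P (on_ob M x)) (on_ob M x) (on_ob M y) (on_hom M x y f) (pr (on_ob M x) j)))
        (inj (on_ob M x) b))"
    by (subst pr_power_module_inj)
      (simp_all add: kcategory.elem_mat_closed[OF C] Comp_assoc pr_inj pr_inj_assoc del: matrix_cat_simps,
        simp add: elem_mat_def)
qed (simp_all add: power_module_closed del: matrix_cat_simps)

end

text \<open>A diagonal map applies \<open>\<eta>\<close> to every coordinate, so at entry
  \<open>(i, j)\<close> the square is the naturality square of \<open>\<eta>\<close> for
  \<open>A $$ (i, j)\<close>.\<close>

lemma power_functor_nat_trans:
  assumes M: "klinear_functor K C D M" and M': "klinear_functor K C D M'"
    and \<eta>: "\<eta> \<in> nat_trans C D M M'"
  shows "on_hom power_functor M M' \<eta> \<in> nat_trans MC D (power_module M) (power_module M')"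
proof (rule nat_transI, goal_cases)
  case (1 x)
  then show ?case
    using nat_trans_closed[OF \<eta>] by (simp add: power_module_ob klinear_functor_simps[OF M] klinear_functor_simps[OF M'])
next
  case 2
  then show ?case by simp
next
  case (3 x y A)
  note [simp] = klinear_functor_simps[OF M] klinear_functor_simps[OF M'] nat_trans_closed[OF \<eta>]
  from 3 have [simp]: "x \<in> Ob C" "y \<in> Ob C" by simp_all
  note [simp] = power_module_closed[OF M _ _ 3(3)] power_module_closed[OF M' _ _ 3(3)]
    pr_power_module_inj[OF M _ _ 3(3)] pr_power_module_inj[OF M' _ _ 3(3)]
  let ?x = "on_ob M x" and ?y = "on_ob M y" and ?x' = "on_ob M' x" and ?y' = "on_ob M' y"
  have "Comp D (P ?x) (P ?y) (P ?y') (diag ?y ?y' (\<eta> y)) (on_hom (power_module M) x y A) =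
      Comp D (P ?x) (P ?x') (P ?y') (on_hom (power_module M') x y A) (diag ?x ?x' (\<eta> x))"
  proof (rule pr_inj_ext[of ?x ?y'])
    fix i j
    assume ij: "i < n" "j < n"
    then have A: "A $$ (i, j) \<in> carrier (Hom C x y)" using 3 by simp
    have "Comp D ?x (P ?y') ?y' (pr ?y' i) (Comp D ?x (P ?x) (P ?y')
        (Comp D (P ?x) (P ?y) (P ?y') (diag ?y ?y' (\<eta> y)) (on_hom (power_module M) x y A)) (inj ?x j)) =
      Comp D ?x ?y ?y' (\<eta> y) (on_hom M x y (A $$ (i, j)))"
      using ij by (simp add: Comp_assoc pr_diag_assoc)
    also have "\<dots> = Comp D ?x ?x' ?y' (on_hom M' x y (A $$ (i, j))) (\<eta> x)"
      using A by (simp add: nat_trans_naturality[OF \<eta>])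
    also have "\<dots> = Comp D ?x ?x' ?y' (Comp D ?x' (P ?y') ?y' (pr ?y' i)
        (Comp D ?x' (P ?x') (P ?y') (on_hom (power_module M') x y A) (inj ?x' j))) (\<eta> x)"
      using ij by simp
    also have "\<dots> = Comp D ?x (P ?y') ?y' (pr ?y' i) (Comp D ?x (P ?x) (P ?y')
        (Comp D (P ?x) (P ?x') (P ?y') (on_hom (power_module M') x y A) (diag ?x ?x' (\<eta> x))) (inj ?x j))"
      \<comment> \<open>The entry rule is switched off here: it would turn one side back into an
        entry, whereas both sides should end in the same right-nested composite.\<close>
      using ij by (simp add: Comp_assoc diag_inj del: pr_power_module_inj[OF M' _ _ 3(3)])
    finally show "Comp D ?x (P ?y') ?y' (pr ?y' i) (Comp D ?x (P ?x) (P ?y')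
        (Comp D (P ?x) (P ?y) (P ?y') (diag ?y ?y' (\<eta> y)) (on_hom (power_module M) x y A)) (inj ?x j)) =
      Comp D ?x (P ?y') ?y' (pr ?y' i) (Comp D ?x (P ?x) (P ?y')
        (Comp D (P ?x) (P ?x') (P ?y') (on_hom (power_module M') x y A) (diag ?x ?x' (\<eta> x))) (inj ?x j))" .
  qed simp_all
  then show ?case by (simp add: power_module_ob)
qed

lemma klinear_functor_power:
  "klinear_functor K (functor_cat K C D) (functor_cat K MC D) power_functor"
proof (intro klinear_functor.intro klinear_functor_axioms.intro, goal_cases)
  case 1
  show ?case by (rule functor_kcategory[OF kcategory_axioms])
next
  case 2
  show ?case by (rule functor_kcategory[OF kcategory_axioms])
next
  case (3 M)
  then show ?case by (simp add: klinear_functor_power_module)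
next
  case (4 M M')
  then have M: "klinear_functor K C D M" and M': "klinear_functor K C D M'" by simp_all
  show ?case
  proof (rule linear_mapsI, goal_cases)
    case (1 \<eta>)
    then show ?case using power_functor_nat_trans[OF M M'] by simp
  next
    case (2 \<eta> \<theta>)
    then show ?case
      by (auto intro!: restrict_ext diag_add
          simp: power_module_ob nat_trans_closed klinear_functor_simps[OF M] klinear_functor_simps[OF M'])
  next
    case (3 a \<eta>)
    then show ?case
      by (auto intro!: restrict_ext diag_smult
          simp: power_module_ob nat_trans_closed klinear_functor_simps[OF M] klinear_functor_simps[OF M'])
  qed
next
  case (5 L M N \<eta> \<theta>)
  then have L: "klinear_functor K C D L" and M: "klinear_functor K C D M"
    and N: "klinear_functor K C D N" by simp_all
  show ?case using 5
    by (auto intro!: restrict_ext diag_Comp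
          simp: power_module_ob nat_trans_closed klinear_functor_simps[OF L] klinear_functor_simps[OF M]
            klinear_functor_simps[OF N])
next
  case (6 M)
  then have M: "klinear_functor K C D M" by simp
  show ?case by (auto intro!: restrict_ext diag_Ident simp: power_module_ob klinear_functor_simps[OF M])
qed

section \<open>From modules over the matrix category to modules over \<open>C\<close>\<close>

text \<open>The unit of the upper left corner of the matrix category acts as an idempotent, whose image is
  a module over the original category.\<close>

definition idem :: "('o, 'm mat, 'p, 'q) kfun \<Rightarrow> 'o \<Rightarrow> 'q" where
  "idem N x = on_hom N x x (E x x 0 0 (Ident C x))"

definition corner_ob :: "('o, 'm mat, 'p, 'q) kfun \<Rightarrow> 'o \<Rightarrow> 'p" where
  "corner_ob N x = S (on_ob N x) (idem N x)"

definition corner_sec :: "('o, 'm mat, 'p, 'q) kfun \<Rightarrow> 'o \<Rightarrow> 'q" where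
  "corner_sec N x = sec (on_ob N x) (idem N x)"

definition corner_ret :: "('o, 'm mat, 'p, 'q) kfun \<Rightarrow> 'o \<Rightarrow> 'q" where
  "corner_ret N x = ret (on_ob N x) (idem N x)"

definition corner_module :: "('o, 'm mat, 'p, 'q) kfun \<Rightarrow> ('o, 'm, 'p, 'q) kfun" where
  "corner_module N = \<lparr>on_ob = corner_ob N,
     on_hom = (\<lambda>x y f. Comp D (corner_ob N x) (on_ob N y) (corner_ob N y) (corner_ret N y)
       (Comp D (corner_ob N x) (on_ob N x) (on_ob N y) (on_hom N x y (E x y 0 0 f))
         (corner_sec N x)))\<rparr>"

lemma corner_module_simps [simp]:
  "on_ob (corner_module N) x = corner_ob N x"
  "on_hom (corner_module N) x y f =
    Comp D (corner_ob N x) (on_ob N y) (corner_ob N y) (corner_ret N y)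
       (Comp D (corner_ob N x) (on_ob N x) (on_ob N y) (on_hom N x y (E x y 0 0 f))
         (corner_sec N x))"
  by (simp_all add: corner_module_def)

definition corner_functor ::
  "(('o, 'm mat, 'p, 'q) kfun, 'o \<Rightarrow> 'q, ('o, 'm, 'p, 'q) kfun, 'o \<Rightarrow> 'q) kfun" where
  "corner_functor = \<lparr>on_ob = corner_module,
     on_hom = (\<lambda>N N' \<theta>. \<lambda>x\<in>Ob C. Comp D (corner_ob N x) (on_ob N' x) (corner_ob N' x) (corner_ret N' x)
       (Comp D (corner_ob N x) (on_ob N x) (on_ob N' x) (\<theta> x) (corner_sec N x)))\<rparr>"

lemma corner_functor_simps [simp]:
  "on_ob corner_functor N = corner_module N"
  "on_hom corner_functor N N' \<theta> =
    (\<lambda>x\<in>Ob C. Comp D (corner_ob N x) (on_ob N' x) (corner_ob N' x) (corner_ret N' x)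
       (Comp D (corner_ob N x) (on_ob N x) (on_ob N' x) (\<theta> x) (corner_sec N x)))"
  by (simp_all add: corner_functor_def)

context
  fixes N assumes N: "klinear_functor K MC D N"
begin

lemma matrix_module_ob [simp]: "x \<in> Ob C \<Longrightarrow> on_ob N x \<in> Ob D"
  using klinear_functor.on_ob_closed[OF N] by simp

lemma action_elem_closed [simp]:
  "\<lbrakk>x \<in> Ob C; y \<in> Ob C; f \<in> carrier (Hom C x y)\<rbrakk> \<Longrightarrow>
    on_hom N x y (E x y i j f) \<in> carrier (Hom D (on_ob N x) (on_ob N y))"
  using klinear_functor.on_hom_closed[OF N, of x y "E x y i j f"] kcategory.elem_mat_closed[OF C]
  by simp

text \<open>Functoriality transports the multiplication table of elementary matrices to their
  actions, so products of actions collapse by rewriting.\<close>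

lemma action_elem_Comp [simp]:
  assumes "x \<in> Ob C" "y \<in> Ob C" "z \<in> Ob C" "f \<in> carrier (Hom C x y)" "g \<in> carrier (Hom C y z)"
    and "j < n" "j' < n"
  shows "Comp D (on_ob N x) (on_ob N y) (on_ob N z)
      (on_hom N y z (E y z i j g)) (on_hom N x y (E x y j' l f)) =
    (if j = j' then on_hom N x z (E x z i l (Comp C x y z g f))
     else \<zero>\<^bsub>Hom D (on_ob N x) (on_ob N z)\<^esub>)"
proof -
  have "Comp D (on_ob N x) (on_ob N y) (on_ob N z)
      (on_hom N y z (E y z i j g)) (on_hom N x y (E x y j' l f)) =
    on_hom N x z (Comp MC x y z (E y z i j g) (E x y j' l f))"
    using assms kcategory.elem_mat_closed[OF C]
    by (intro klinear_functor.on_hom_Comp[OF N, symmetric]) simp_all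
  also have "\<dots> = (if j = j' then on_hom N x z (E x z i l (Comp C x y z g f))
     else on_hom N x z \<zero>\<^bsub>Hom MC x z\<^esub>)"
    by (subst kcategory.elem_mat_Comp[OF C]) (use assms in simp_all)
  also have "on_hom N x z \<zero>\<^bsub>Hom MC x z\<^esub> = \<zero>\<^bsub>Hom D (on_ob N x) (on_ob N z)\<^esub>"
    using assms by (intro klinear_functor.on_hom_zero[OF N]) simp_all
  finally show ?thesis .
qed

lemma action_elem_Comp_assoc [simp]:
  assumes "x \<in> Ob C" "y \<in> Ob C" "z \<in> Ob C" "f \<in> carrier (Hom C x y)" "g \<in> carrier (Hom C y z)"
    and "j < n" "j' < n" "X \<in> Ob D" "h \<in> carrier (Hom D X (on_ob N x))"
  shows "Comp D X (on_ob N y) (on_ob N z) (on_hom N y z (E y z i j g))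
      (Comp D X (on_ob N x) (on_ob N y) (on_hom N x y (E x y j' l f)) h) =
    (if j = j' then Comp D X (on_ob N x) (on_ob N z) (on_hom N x z (E x z i l (Comp C x y z g f))) h
     else \<zero>\<^bsub>Hom D X (on_ob N z)\<^esub>)"
  using assms by (simp add: Comp_assoc[symmetric])

lemma corner_splits_idem [simp]:
  assumes "x \<in> Ob C"
  shows "corner_ob N x \<in> Ob D"
    and "corner_sec N x \<in> carrier (Hom D (corner_ob N x) (on_ob N x))"
    and "corner_ret N x \<in> carrier (Hom D (on_ob N x) (corner_ob N x))"
    and "Comp D (corner_ob N x) (on_ob N x) (corner_ob N x) (corner_ret N x) (corner_sec N x) =
      Ident D (corner_ob N x)"
    and "Comp D (on_ob N x) (corner_ob N x) (on_ob N x) (corner_sec N x) (corner_ret N x) =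
      on_hom N x x (E x x 0 0 (Ident C x))"
  using split[of "on_ob N x" "idem N x"] assms
  unfolding corner_ob_def corner_sec_def corner_ret_def by (simp_all add: idem_def)

lemma sec_ret_assoc [simp]:
  assumes "x \<in> Ob C" "X \<in> Ob D" "h \<in> carrier (Hom D X (on_ob N x))"
  shows "Comp D X (corner_ob N x) (on_ob N x) (corner_sec N x)
      (Comp D X (on_ob N x) (corner_ob N x) (corner_ret N x) h) =
    Comp D X (on_ob N x) (on_ob N x) (on_hom N x x (E x x 0 0 (Ident C x))) h"
  using assms by (simp add: Comp_assoc[symmetric])

text \<open>Write \<open>s\<close>, \<open>r\<close> and \<open>e\<close> for section, retraction
  and idempotent. Then \<open>e s = s r s = s\<close>, since \<open>r s = 1\<close>.\<close>

lemma elem_sec [simp]: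
  assumes "x \<in> Ob C"
  shows "Comp D (corner_ob N x) (on_ob N x) (on_ob N x) (on_hom N x x (E x x 0 0 (Ident C x)))
    (corner_sec N x) = corner_sec N x"
  using assms Comp_assoc[of "corner_ob N x" "on_ob N x" "corner_ob N x" "on_ob N x"
      "corner_sec N x" "corner_ret N x" "corner_sec N x"] by simp

text \<open>The dual absorption \<open>r e = r s r = r\<close>, stated with a further map
  \<open>h\<close> behind it.\<close>

lemma ret_elem_assoc [simp]:
  assumes "x \<in> Ob C" "X \<in> Ob D" "h \<in> carrier (Hom D X (on_ob N x))"
  shows "Comp D X (on_ob N x) (corner_ob N x) (corner_ret N x)
      (Comp D X (on_ob N x) (on_ob N x) (on_hom N x x (E x x 0 0 (Ident C x))) h) =
    Comp D X (on_ob N x) (corner_ob N x) (corner_ret N x) h"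
proof -
  have "Comp D X (on_ob N x) (corner_ob N x) (corner_ret N x)
      (Comp D X (on_ob N x) (on_ob N x) (on_hom N x x (E x x 0 0 (Ident C x))) h) =
    Comp D X (on_ob N x) (corner_ob N x) (corner_ret N x) (Comp D X (corner_ob N x) (on_ob N x)
      (corner_sec N x) (Comp D X (on_ob N x) (corner_ob N x) (corner_ret N x) h))"
    using assms by simp
  also have "\<dots> = Comp D X (corner_ob N x) (corner_ob N x)
      (Comp D (corner_ob N x) (on_ob N x) (corner_ob N x) (corner_ret N x) (corner_sec N x))
      (Comp D X (on_ob N x) (corner_ob N x) (corner_ret N x) h)"
    using assms by (intro Comp_assoc[symmetric]) simp_all
  also have "\<dots> = Comp D X (on_ob N x) (corner_ob N x) (corner_ret N x) h"
    using assms by simp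
  finally show ?thesis .
qed

text \<open>In a composite of two actions the inner \<open>s r\<close> is the action of
  \<open>E_00\<close>. It is absorbed by its neighbours, and
  \<open>(g E_00) (f E_00) = (g f) E_00\<close>.\<close>

lemma klinear_functor_corner_module: "klinear_functor K C D (corner_module N)"
proof (intro klinear_functor.intro klinear_functor_axioms.intro, goal_cases)
  case 1
  show ?case by (rule C)
next
  case 2
  show ?case by (rule kcategory_axioms)
next
  case (3 x)
  then show ?case by simp
next
  case (4 x y)
  then have "(\<lambda>f. on_hom N x y (E x y 0 0 f)) \<in> linear_maps K (Hom C x y) (Hom D (on_ob N x) (on_ob N y))"
    using klinear_functor.on_hom_linear[OF N, of x y]
    by (intro linear_maps_comp[OF kcategory.elem_mat_linear[OF C]]) simp_all
  note lin = linear_mapsD[OF this]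
  show ?case
    by (rule linear_mapsI)
      (use 4 in \<open>simp_all add: lin Comp_add_left Comp_add_right Comp_smult_left Comp_smult_right\<close>)
next
  case (5 x y z f g)
  then show ?case by (simp add: Comp_assoc)
next
  case (6 x)
  then show ?case by simp
qed

end

lemma nat_trans_elem:
  assumes "klinear_functor K MC D N" "klinear_functor K MC D N'" "\<theta> \<in> nat_trans MC D N N'"
    and "x \<in> Ob C" "y \<in> Ob C" "f \<in> carrier (Hom C x y)"
  shows "Comp D (on_ob N x) (on_ob N y) (on_ob N' y) (\<theta> y) (on_hom N x y (E x y i j f)) =
    Comp D (on_ob N x) (on_ob N' x) (on_ob N' y) (on_hom N' x y (E x y i j f)) (\<theta> x)"
  using assms kcategory.elem_mat_closed[OF C] by (intro nat_trans_naturality[OF assms(3)]) simp_all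

lemma nat_trans_elem_assoc:
  assumes N: "klinear_functor K MC D N" and N': "klinear_functor K MC D N'"
    and \<theta>: "\<theta> \<in> nat_trans MC D N N'"
    and xy: "x \<in> Ob C" "y \<in> Ob C" and f: "f \<in> carrier (Hom C x y)"
    and h: "X \<in> Ob D" "h \<in> carrier (Hom D X (on_ob N x))"
  shows "Comp D X (on_ob N y) (on_ob N' y) (\<theta> y)
      (Comp D X (on_ob N x) (on_ob N y) (on_hom N x y (E x y i j f)) h) =
    Comp D X (on_ob N' x) (on_ob N' y) (on_hom N' x y (E x y i j f))
      (Comp D X (on_ob N x) (on_ob N' x) (\<theta> x) h)"
  using assms nat_trans_closed[OF \<theta>]
    Comp_assoc[of X "on_ob N x" "on_ob N y" "on_ob N' y" h "on_hom N x y (E x y i j f)" "\<theta> y"]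
  by (simp add: matrix_module_ob[OF N] matrix_module_ob[OF N'] action_elem_closed[OF N] action_elem_closed[OF N']
      nat_trans_elem[OF N N' \<theta>] Comp_assoc)

lemmas corner_simps = matrix_module_ob action_elem_closed action_elem_Comp action_elem_Comp_assoc corner_splits_idem sec_ret_assoc elem_sec
  ret_elem_assoc

text \<open>The components of \<open>\<theta>\<close> commute with the actions of elementary
  matrices, so each inner \<open>s r\<close> slides past \<open>\<theta>\<close> and is
  absorbed.\<close>

lemma corner_functor_nat_trans:
  assumes N: "klinear_functor K MC D N" and N': "klinear_functor K MC D N'"
    and \<theta>: "\<theta> \<in> nat_trans MC D N N'"
  shows "on_hom corner_functor N N' \<theta> \<in> nat_trans C D (corner_module N) (corner_module N')"
proof -
  have [simp]: "x \<in> Ob C \<Longrightarrow> \<theta> x \<in> carrier (Hom D (on_ob N x) (on_ob N' x))" for x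
    using nat_trans_closed[OF \<theta>] by simp
  show ?thesis
    by (rule nat_transI)
      (simp_all add: corner_simps[OF N] corner_simps[OF N'] Comp_assoc nat_trans_elem_assoc[OF N N' \<theta>])
qed

lemma klinear_functor_corner:
  "klinear_functor K (functor_cat K MC D) (functor_cat K C D) corner_functor"
proof (intro klinear_functor.intro klinear_functor_axioms.intro, goal_cases)
  case 1
  show ?case by (rule functor_kcategory[OF kcategory_axioms])
next
  case 2
  show ?case by (rule functor_kcategory[OF kcategory_axioms])
next
  case (3 N)
  then show ?case by (simp add: klinear_functor_corner_module)
next
  case (4 N N')
  then have N: "klinear_functor K MC D N" and N': "klinear_functor K MC D N'" by simp_all
  have closed: "\<theta> x \<in> carrier (Hom D (on_ob N x) (on_ob N' x))"
    if "\<theta> \<in> nat_trans MC D N N'" "x \<in> Ob C" for x \<theta>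
    using nat_trans_closed[OF that(1)] that(2) by simp
  show ?case
  proof (rule linear_mapsI, goal_cases)
    case (1 \<theta>)
    then show ?case using corner_functor_nat_trans[OF N N'] by simp
  next
    case (2 \<theta> \<zeta>)
    then show ?case
      by (simp add: corner_simps[OF N] corner_simps[OF N'] closed Comp_add_left Comp_add_right
          cong: restrict_cong)
  next
    case (3 a \<theta>)
    then show ?case
      by (simp add: corner_simps[OF N] corner_simps[OF N'] closed Comp_smult_left Comp_smult_right
          cong: restrict_cong)
  qed
next
  case (5 L M N \<theta> \<zeta>)
  then have L: "klinear_functor K MC D L" and M: "klinear_functor K MC D M"
    and N: "klinear_functor K MC D N" and \<theta>: "\<theta> \<in> nat_trans MC D L M"
    and \<zeta>: "\<zeta> \<in> nat_trans MC D M N" by simp_all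
  have [simp]: "x \<in> Ob C \<Longrightarrow> \<theta> x \<in> carrier (Hom D (on_ob L x) (on_ob M x))"
    "x \<in> Ob C \<Longrightarrow> \<zeta> x \<in> carrier (Hom D (on_ob M x) (on_ob N x))" for x
    using nat_trans_closed[OF \<theta>] nat_trans_closed[OF \<zeta>] by simp_all
  show ?case
    by (simp add: corner_simps[OF L] corner_simps[OF M] corner_simps[OF N] Comp_assoc
        nat_trans_elem_assoc[OF M N \<zeta>] cong: restrict_cong)
next
  case (6 N)
  then have N: "klinear_functor K MC D N" by simp
  show ?case by (simp add: corner_simps[OF N] cong: restrict_cong)
qed

section \<open>The two composites are isomorphic to the identity functors\<close>

lemma corner_power_iso:
  "naturally_isomorphic (functor_cat K C D) (functor_cat K C D)
    (comp_functor corner_functor power_functor) id_functor"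
proof -
  \<comment> \<open>In the power module the corner idempotent has two splittings: the chosen one,
    and the one through \<open>on_ob M x\<close> with section \<open>inj 0\<close> and retraction
    \<open>pr 0\<close>. \<open>\<gamma>\<close> and \<open>\<delta>\<close> are the canonical
    mutually inverse maps between these.\<close>
  define \<gamma> where "\<gamma> M x = Comp D (corner_ob (power_module M) x) (P (on_ob M x)) (on_ob M x)
    (pr (on_ob M x) 0) (corner_sec (power_module M) x)" for M x
  define \<delta> where "\<delta> M x = Comp D (on_ob M x) (P (on_ob M x)) (corner_ob (power_module M) x)
    (corner_ret (power_module M) x) (inj (on_ob M x) 0)" for M x
  have nat: "restrict (\<gamma> M) (Ob C) \<in> nat_trans C D (corner_module (power_module M)) M"
    if M: "klinear_functor K C D M" for M
    by (rule nat_transI)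
      (simp_all add: \<gamma>_def power_module_ob klinear_functor_simps[OF M] Comp_assoc power_module_elem_mat[OF M] pr_inj_assoc
        corner_simps[OF klinear_functor_power_module[OF M], unfolded power_module_ob])
  have iso: "iso_in (functor_cat K C D) (corner_module (power_module M)) M (restrict (\<gamma> M) (Ob C))"
    if M: "klinear_functor K C D M" for M
  proof (rule functor_isoI[where \<theta> = "\<delta> M"])
    note N = klinear_functor_power_module[OF M]
    note simps = corner_simps[OF N, unfolded power_module_ob] klinear_functor_simps[OF M]
    fix x
    assume x: "x \<in> Ob C"
    let ?N = "power_module M" and ?V = "on_ob M x"
    show "\<delta> M x \<in> carrier (Hom D (on_ob M x) (on_ob (corner_module ?N) x))"
      using x by (simp add: \<delta>_def simps)
    \<comment> \<open>This is \<open>elem_sec\<close> with the idempotent written as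
      \<open>inj 0\<close> after \<open>pr 0\<close>.\<close>
    have e: "Comp D (corner_ob ?N x) ?V (P ?V) (inj ?V 0)
        (Comp D (corner_ob ?N x) (P ?V) ?V (pr ?V 0) (corner_sec ?N x)) = corner_sec ?N x"
      using elem_sec[OF N x] x
      by (simp add: power_module_ob power_module_elem_mat[OF M] Comp_assoc simps)
    show "Comp D (on_ob (corner_module ?N) x) (on_ob M x) (on_ob (corner_module ?N) x)
        (\<delta> M x) (restrict (\<gamma> M) (Ob C) x) = Ident D (on_ob (corner_module ?N) x)"
      using x by (simp add: \<gamma>_def \<delta>_def Comp_assoc e simps)
    show "Comp D (on_ob M x) (on_ob (corner_module ?N) x) (on_ob M x)
        (restrict (\<gamma> M) (Ob C) x) (\<delta> M x) = Ident D (on_ob M x)"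
      using x by (simp add: \<gamma>_def \<delta>_def Comp_assoc power_module_elem_mat[OF M] pr_inj pr_inj_assoc simps)
  qed (use M nat[OF M] in \<open>simp_all add: klinear_functor_corner_module klinear_functor_power_module\<close>)
  have "(\<lambda>M\<in>Ob (functor_cat K C D). restrict (\<gamma> M) (Ob C)) \<in> nat_trans (functor_cat K C D)
      (functor_cat K C D) (comp_functor corner_functor power_functor) id_functor"
  proof (rule nat_transI, goal_cases)
    case (1 M)
    then show ?case using nat by simp
  next
    case 2
    show ?case by simp
  next
    case (3 M M' \<eta>)
    then have M: "klinear_functor K C D M" and M': "klinear_functor K C D M'"
      and \<eta>: "\<eta> \<in> nat_trans C D M M'" by simp_all
    note simps = corner_simps[OF klinear_functor_power_module[OF M], unfolded power_module_ob]
      corner_simps[OF klinear_functor_power_module[OF M'], unfolded power_module_ob]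
      klinear_functor_simps[OF M] klinear_functor_simps[OF M'] nat_trans_closed[OF \<eta>]
    show ?case using M M'
      by (simp add: \<gamma>_def Comp_assoc power_module_ob power_module_elem_mat[OF M'] pr_inj_assoc pr_diag_assoc
          simps cong: restrict_cong)
  qed
  then show ?thesis unfolding naturally_isomorphic_def
    by (rule bexI[rotated]) (use iso in simp)
qed

text \<open>Write \<open>s\<close> and \<open>r\<close> for section and retraction of the corner.
  Entry \<open>(i, j)\<close> of \<open>\<beta> \<alpha>\<close> is \<open>r E_0i E_j0 s\<close>,
  which is 0 for distinct indices and \<open>r E_00 s = 1\<close> on the diagonal. Conversely
  \<open>\<alpha> \<beta>\<close> is the sum of
  \<open>E_i0 s r E_0i = E_i0 E_00 E_0i = E_ii\<close>, hence the identity.\<close>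

lemma power_corner_iso:
  "naturally_isomorphic (functor_cat K MC D) (functor_cat K MC D)
    (comp_functor power_functor corner_functor) id_functor"
proof -
  define \<alpha> where "\<alpha> N x = cotuple (corner_ob N x) (on_ob N x)
    (\<lambda>i. Comp D (corner_ob N x) (on_ob N x) (on_ob N x) (on_hom N x x (E x x i 0 (Ident C x)))
      (corner_sec N x))" for N x
  define \<beta> where "\<beta> N x = tuple (on_ob N x) (corner_ob N x)
    (\<lambda>i. Comp D (on_ob N x) (on_ob N x) (corner_ob N x) (corner_ret N x)
      (on_hom N x x (E x x 0 i (Ident C x))))" for N x
  have \<alpha>_closed: "\<alpha> N x \<in> carrier (Hom D (P (corner_ob N x)) (on_ob N x))"
    and \<beta>_closed: "\<beta> N x \<in> carrier (Hom D (on_ob N x) (P (corner_ob N x)))"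
    if "klinear_functor K MC D N" "x \<in> Ob C" for N x
    using that(2) by (simp_all add: \<alpha>_def \<beta>_def corner_simps[OF that(1)] Pi_iff)
  have \<alpha>_inj: "Comp D (corner_ob N x) (P (corner_ob N x)) (on_ob N x) (\<alpha> N x) (inj (corner_ob N x) i) =
      Comp D (corner_ob N x) (on_ob N x) (on_ob N x) (on_hom N x x (E x x i 0 (Ident C x)))
        (corner_sec N x)"
    if "klinear_functor K MC D N" "x \<in> Ob C" "i < n" for N x i
    using that(2,3) by (simp add: \<alpha>_def corner_simps[OF that(1)] cotuple_inj Pi_iff)
  have pr_\<beta>: "Comp D (on_ob N x) (P (corner_ob N x)) (corner_ob N x) (pr (corner_ob N x) i) (\<beta> N x) =
      Comp D (on_ob N x) (on_ob N x) (corner_ob N x) (corner_ret N x)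
        (on_hom N x x (E x x 0 i (Ident C x)))"
    if "klinear_functor K MC D N" "x \<in> Ob C" "i < n" for N x i
    using that(2,3) by (simp add: \<beta>_def corner_simps[OF that(1)] pr_tuple Pi_iff)
  have nat: "restrict (\<alpha> N) (Ob C) \<in> nat_trans MC D (power_module (corner_module N)) N"
    if N: "klinear_functor K MC D N" for N
  proof (rule nat_transI, goal_cases)
    case (1 x)
    then show ?case using \<alpha>_closed[OF N] by (simp add: power_module_ob)
  next
    case 2
    show ?case by simp
  next
    case (3 x y A)
    note M = klinear_functor_corner_module[OF N]
    from 3 have [simp]: "x \<in> Ob C" "y \<in> Ob C" by simp_all
    note [simp] = corner_simps[OF N] \<alpha>_closed[OF N] power_module_closed[OF M _ _ 3(3), unfolded corner_module_simps(1)]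
    have [simp]: "on_hom N x y A \<in> carrier (Hom D (on_ob N x) (on_ob N y))"
      using klinear_functor.on_hom_closed[OF N _ _ 3(3)] by simp
    let ?x = "corner_ob N x" and ?y = "corner_ob N y"
    have "Comp D (P ?x) (P ?y) (on_ob N y) (\<alpha> N y) (on_hom (power_module (corner_module N)) x y A) =
        Comp D (P ?x) (on_ob N x) (on_ob N y) (on_hom N x y A) (\<alpha> N x)"
    proof (rule inj_ext[of "on_ob N y" ?x])
      fix j
      assume j: "j < n"
      have A: "A $$ (i, j) \<in> carrier (Hom C x y)" if "i < n" for i
        using 3 that j by simp
      have EA: "(\<lambda>i. E x y i 0 (A $$ (i, j))) \<in> {..<n} \<rightarrow> carrier (Hom MC x y)"
        using A kcategory.elem_mat_closed[OF C] by (intro Pi_I) simp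
      have E: "E x x j 0 (Ident C x) \<in> carrier (Hom MC x x)"
        using kcategory.elem_mat_closed[OF C] by simp
      have "Comp D ?x (P ?x) (on_ob N y)
          (Comp D (P ?x) (P ?y) (on_ob N y) (\<alpha> N y) (on_hom (power_module (corner_module N)) x y A))
          (inj ?x j) =
        Comp D ?x (P ?y) (on_ob N y) (\<alpha> N y) (tuple ?x ?y (\<lambda>i. on_hom (corner_module N) x y (A $$ (i, j))))"
        using j power_module_inj[OF M _ _ 3(3), of j] by (simp add: Comp_assoc)
      \<comment> \<open>Summand \<open>i\<close> is \<open>E_i0 s r (A_ij E_00) s\<close>; since
        \<open>s r = E_00\<close>, the elementary matrices multiply to
        \<open>A_ij E_i0\<close>.\<close>
      also have "\<dots> = (\<Oplus>\<^bsub>Hom D ?x (on_ob N y)\<^esub>i\<in>{..<n}. Comp D ?x (on_ob N x) (on_ob N y)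
          (on_hom N x y (E x y i 0 (A $$ (i, j)))) (corner_sec N x))"
        unfolding \<alpha>_def using j A by (simp add: cotuple_tuple Pi_iff Comp_assoc)
      also have "\<dots> = Comp D ?x (on_ob N x) (on_ob N y)
          (\<Oplus>\<^bsub>Hom D (on_ob N x) (on_ob N y)\<^esub>i\<in>{..<n}. on_hom N x y (E x y i 0 (A $$ (i, j))))
          (corner_sec N x)"
        using A by (simp add: Comp_finsum_left Pi_iff)
      also have "(\<Oplus>\<^bsub>Hom D (on_ob N x) (on_ob N y)\<^esub>i\<in>{..<n}. on_hom N x y (E x y i 0 (A $$ (i, j)))) =
          on_hom N x y (\<Oplus>\<^bsub>Hom MC x y\<^esub>i\<in>{..<n}. E x y i 0 (A $$ (i, j)))"
        by (rule klinear_functor.on_hom_finsum[OF N _ _ _ EA, symmetric]) simp_all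
      \<comment> \<open>The matrices \<open>A_ij E_i0\<close> add up to column \<open>j\<close> of
        \<open>A\<close> placed in column 0, which is \<open>A E_j0\<close>.\<close>
      also have "\<dots> = on_hom N x y (Comp MC x x y A (E x x j 0 (Ident C x)))"
        using j by (subst kcategory.Comp_elem_mat_column[OF C _ _ 3(3)]) simp_all
      also have "\<dots> = Comp D (on_ob N x) (on_ob N x) (on_ob N y) (on_hom N x y A)
          (on_hom N x x (E x x j 0 (Ident C x)))"
        by (rule klinear_functor.on_hom_Comp[OF N _ _ _ E 3(3)]) simp_all
      also have "Comp D ?x (on_ob N x) (on_ob N y) \<dots> (corner_sec N x) =
          Comp D ?x (P ?x) (on_ob N y) (Comp D (P ?x) (on_ob N x) (on_ob N y) (on_hom N x y A) (\<alpha> N x)) (inj ?x j)"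
        using j by (simp add: Comp_assoc \<alpha>_inj[OF N])
      finally show "Comp D ?x (P ?x) (on_ob N y)
          (Comp D (P ?x) (P ?y) (on_ob N y) (\<alpha> N y) (on_hom (power_module (corner_module N)) x y A))
          (inj ?x j) =
          Comp D ?x (P ?x) (on_ob N y) (Comp D (P ?x) (on_ob N x) (on_ob N y) (on_hom N x y A) (\<alpha> N x)) (inj ?x j)" .
    qed simp_all
    then show ?case by (simp add: power_module_ob)
  qed
  have iso: "iso_in (functor_cat K MC D) (power_module (corner_module N)) N (restrict (\<alpha> N) (Ob C))"
    if N: "klinear_functor K MC D N" for N
  proof (rule functor_isoI[where \<theta> = "\<beta> N"])
    note [simp] = corner_simps[OF N] \<alpha>_closed[OF N] \<beta>_closed[OF N]
    fix x
    assume "x \<in> Ob MC"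
    then have [simp]: "x \<in> Ob C" by simp
    let ?x = "corner_ob N x" and ?M = "power_module (corner_module N)"
    show "\<beta> N x \<in> carrier (Hom D (on_ob N x) (on_ob ?M x))"
      by (simp add: power_module_ob)
    have "Comp D (P ?x) (on_ob N x) (P ?x) (\<beta> N x) (\<alpha> N x) = Ident D (P ?x)"
    proof (rule pr_inj_ext[of ?x ?x])
      fix i j
      assume ij: "i < n" "j < n"
      have "Comp D ?x (P ?x) ?x (pr ?x i) (Comp D ?x (P ?x) (P ?x)
          (Comp D (P ?x) (on_ob N x) (P ?x) (\<beta> N x) (\<alpha> N x)) (inj ?x j)) =
        Comp D ?x (on_ob N x) ?x (Comp D (on_ob N x) (P ?x) ?x (pr ?x i) (\<beta> N x))
          (Comp D ?x (P ?x) (on_ob N x) (\<alpha> N x) (inj ?x j))"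
        using ij by (simp add: Comp_assoc)
      also have "\<dots> = (if i = j then Ident D ?x else \<zero>\<^bsub>Hom D ?x ?x\<^esub>)"
        using ij by (simp add: pr_\<beta>[OF N] \<alpha>_inj[OF N] Comp_assoc)
      also have "\<dots> = Comp D ?x (P ?x) ?x (pr ?x i) (Comp D ?x (P ?x) (P ?x) (Ident D (P ?x)) (inj ?x j))"
        using ij by (simp add: pr_inj)
      finally show "Comp D ?x (P ?x) ?x (pr ?x i) (Comp D ?x (P ?x) (P ?x)
          (Comp D (P ?x) (on_ob N x) (P ?x) (\<beta> N x) (\<alpha> N x)) (inj ?x j)) =
        Comp D ?x (P ?x) ?x (pr ?x i) (Comp D ?x (P ?x) (P ?x) (Ident D (P ?x)) (inj ?x j))" .
    qed simp_all
    then show "Comp D (on_ob ?M x) (on_ob N x) (on_ob ?M x) (\<beta> N x) (restrict (\<alpha> N) (Ob C) x) =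
        Ident D (on_ob ?M x)"
      by (simp add: power_module_ob)
    have EI: "(\<lambda>i. E x x i i (Ident C x)) \<in> {..<n} \<rightarrow> carrier (Hom MC x x)"
      using kcategory.elem_mat_closed[OF C] by (intro Pi_I) simp
    have "Comp D (on_ob N x) (P ?x) (on_ob N x) (\<alpha> N x) (\<beta> N x) =
      (\<Oplus>\<^bsub>Hom D (on_ob N x) (on_ob N x)\<^esub>i\<in>{..<n}. on_hom N x x (E x x i i (Ident C x)))"
      unfolding \<alpha>_def \<beta>_def by (simp add: cotuple_tuple Pi_iff Comp_assoc)
    also have "\<dots> = on_hom N x x (\<Oplus>\<^bsub>Hom MC x x\<^esub>i\<in>{..<n}. E x x i i (Ident C x))"
      by (rule klinear_functor.on_hom_finsum[OF N _ _ _ EI, symmetric]) simp_all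
    also have "\<dots> = Ident D (on_ob N x)"
      by (subst kcategory.sum_elem_mat_Ident[OF C]) (simp_all only: \<open>x \<in> Ob C\<close> klinear_functor.on_hom_Ident[OF N] matrix_cat_simps(1))
    finally show "Comp D (on_ob N x) (on_ob ?M x) (on_ob N x) (restrict (\<alpha> N) (Ob C) x) (\<beta> N x) =
        Ident D (on_ob N x)"
      by (simp add: power_module_ob)
  qed (use N nat[OF N] in \<open>simp_all add: klinear_functor_corner_module klinear_functor_power_module\<close>)
  have "(\<lambda>N\<in>Ob (functor_cat K MC D). restrict (\<alpha> N) (Ob C)) \<in> nat_trans (functor_cat K MC D)
      (functor_cat K MC D) (comp_functor power_functor corner_functor) id_functor"
  proof (rule nat_transI, goal_cases)
    case (1 N)
    then show ?case using nat by simp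
  next
    case 2
    show ?case by simp
  next
    case (3 N N' \<theta>)
    then have N: "klinear_functor K MC D N" and N': "klinear_functor K MC D N'"
      and \<theta>: "\<theta> \<in> nat_trans MC D N N'" by simp_all
    have [simp]: "x \<in> Ob C \<Longrightarrow> \<theta> x \<in> carrier (Hom D (on_ob N x) (on_ob N' x))" for x
      using nat_trans_closed[OF \<theta>] by simp
    note [simp] = corner_simps[OF N] corner_simps[OF N'] \<alpha>_closed[OF N] \<alpha>_closed[OF N']
    have "Comp D (P (corner_ob N x)) (P (corner_ob N' x)) (on_ob N' x) (\<alpha> N' x)
        (diag (corner_ob N x) (corner_ob N' x) (on_hom corner_functor N N' \<theta> x)) =
      Comp D (P (corner_ob N x)) (on_ob N x) (on_ob N' x) (\<theta> x) (\<alpha> N x)" if x: "x \<in> Ob C" for x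
    proof (rule inj_ext[of "on_ob N' x" "corner_ob N x"])
      fix j
      assume j: "j < n"
      let ?x = "corner_ob N x" and ?x' = "corner_ob N' x"
      let ?t = "on_hom corner_functor N N' \<theta> x"
      have t: "?t \<in> carrier (Hom D ?x ?x')" using x by simp
      have "Comp D ?x (P ?x) (on_ob N' x)
          (Comp D (P ?x) (P ?x') (on_ob N' x) (\<alpha> N' x) (diag ?x ?x' ?t)) (inj ?x j) =
        Comp D ?x (P ?x') (on_ob N' x) (\<alpha> N' x) (Comp D ?x ?x' (P ?x') (inj ?x' j) ?t)"
        using j x t by (simp add: Comp_assoc diag_inj del: corner_functor_simps)
      also have "\<dots> = Comp D ?x ?x' (on_ob N' x) (Comp D ?x' (P ?x') (on_ob N' x) (\<alpha> N' x) (inj ?x' j)) ?t"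
        using j x t by (simp add: Comp_assoc del: corner_functor_simps)
      \<comment> \<open>With primes for the maps of \<open>N'\<close>: \<open>E_j0 s' r' \<theta> s
        = E_j0 E_00 \<theta> s = E_j0 \<theta> s\<close>, and \<open>\<theta>\<close> commutes with
        \<open>E_j0\<close>.\<close>
      also have "\<dots> = Comp D ?x (on_ob N x) (on_ob N' x) (\<theta> x)
          (Comp D ?x (P ?x) (on_ob N x) (\<alpha> N x) (inj ?x j))"
        using j x by (simp add: \<alpha>_inj[OF N] \<alpha>_inj[OF N'] Comp_assoc nat_trans_elem_assoc[OF N N' \<theta>])
      also have "\<dots> = Comp D ?x (P ?x) (on_ob N' x)
          (Comp D (P ?x) (on_ob N x) (on_ob N' x) (\<theta> x) (\<alpha> N x)) (inj ?x j)"
        using j x by (simp add: Comp_assoc)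
      finally show "Comp D ?x (P ?x) (on_ob N' x)
          (Comp D (P ?x) (P ?x') (on_ob N' x) (\<alpha> N' x) (diag ?x ?x' ?t)) (inj ?x j) =
        Comp D ?x (P ?x) (on_ob N' x)
          (Comp D (P ?x) (on_ob N x) (on_ob N' x) (\<theta> x) (\<alpha> N x)) (inj ?x j)" .
    qed (use x in simp_all)
    then show ?case using N N' by (simp add: power_module_ob cong: restrict_cong)
  qed
  then show ?thesis unfolding naturally_isomorphic_def
    by (rule bexI[rotated]) (use iso in simp)
qed

theorem functor_cat_matrix_equivalent:
  "klinearly_equivalent K (functor_cat K C D) (functor_cat K MC D)"
  unfolding klinearly_equivalent_def
  using klinear_functor_power klinear_functor_corner corner_power_iso power_corner_iso by blast

end

section \<open>The category of vector spaces\<close>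

lemma vect_cat_simps [simp]:
  "V \<in> Ob (vect_cat K) \<longleftrightarrow> module K V"
  "carrier (Hom (vect_cat K) V W) = linear_maps K V W \<inter> extensional (carrier V)"
  "\<zero>\<^bsub>Hom (vect_cat K) V W\<^esub> = (\<lambda>v\<in>carrier V. \<zero>\<^bsub>W\<^esub>)"
  "f \<oplus>\<^bsub>Hom (vect_cat K) V W\<^esub> g = (\<lambda>v\<in>carrier V. f v \<oplus>\<^bsub>W\<^esub> g v)"
  "a \<odot>\<^bsub>Hom (vect_cat K) V W\<^esub> f = (\<lambda>v\<in>carrier V. a \<odot>\<^bsub>W\<^esub> f v)"
  "Comp (vect_cat K) U V W g f = (\<lambda>u\<in>carrier U. g (f u))"
  "Ident (vect_cat K) V = (\<lambda>v\<in>carrier V. v)"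
  by (simp_all add: vect_cat_def)

lemma restrict_eq_extensional:
  "\<lbrakk>f \<in> extensional A; \<And>x. x \<in> A \<Longrightarrow> g x = f x\<rbrakk> \<Longrightarrow> restrict g A = f"
  by (auto simp: fun_eq_iff extensional_def)

text \<open>Sums and multiples of elements of the carrier stay in it, so changing a map outside the
  carrier does not affect linearity.\<close>

lemma linear_maps_restrict:
  assumes "module K V" "f \<in> linear_maps K V W"
  shows "restrict f (carrier V) \<in> linear_maps K V W"
proof -
  interpret module K V by fact
  show ?thesis using assms(2) by (auto simp: linear_maps_def)
qed

lemma vect_Hom_module:
  assumes V: "module K V" and W: "module K W"
  shows "module K (Hom (vect_cat K) V W)"
proof -
  interpret V: module K V by fact
  interpret W: module K W by fact
  have add: "(\<lambda>v. f v \<oplus>\<^bsub>W\<^esub> g v) \<in> linear_maps K V W"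
    if "f \<in> linear_maps K V W" "g \<in> linear_maps K V W" for f g
    by (rule linear_mapsI)
      (simp_all add: linear_mapsD[OF that(1)] linear_mapsD[OF that(2)] W.M.a_ac W.smult_r_distr)
  have smult: "(\<lambda>v. a \<odot>\<^bsub>W\<^esub> f v) \<in> linear_maps K V W"
    if "f \<in> linear_maps K V W" "a \<in> carrier K" for f a
    by (rule linear_mapsI)
      (use that in \<open>simp_all add: linear_mapsD[OF that(1)] W.smult_r_distr
        W.smult_assoc1[symmetric] V.R.m_comm\<close>)
  have zero: "(\<lambda>v. \<zero>\<^bsub>W\<^esub>) \<in> linear_maps K V W"
    by (rule linear_mapsI) simp_all
  note closed = linear_mapsD(1)
  show ?thesis
  proof (rule moduleI_null, goal_cases)
    case 1
    show ?case by (rule V.R.is_cring)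
  next
    case (2 f g)
    then show ?case by (simp add: linear_maps_restrict[OF V add])
  next
    case 3
    show ?case by (simp add: linear_maps_restrict[OF V zero])
  next
    case (4 f g h)
    then show ?case by (auto intro!: restrict_ext W.M.a_assoc dest: closed)
  next
    case (5 f g)
    then show ?case by (auto intro!: restrict_ext W.M.a_comm dest: closed)
  next
    case (6 f)
    then show ?case by (auto intro!: restrict_eq_extensional W.M.l_zero dest: closed)
  next
    case (7 a f)
    then show ?case by (simp add: linear_maps_restrict[OF V smult])
  next
    case (8 a b f)
    then show ?case by (auto intro!: restrict_ext W.smult_l_distr dest: closed)
  next
    case (9 a f g)
    then show ?case by (auto intro!: restrict_ext W.smult_r_distr dest: closed)
  next
    case (10 a b f)
    then show ?case by (auto intro!: restrict_ext W.smult_assoc1 dest: closed)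
  next
    case (11 f)
    then show ?case by (auto intro!: restrict_eq_extensional W.smult_one dest: closed)
  next
    case (12 f)
    then show ?case by (auto intro!: restrict_ext W.smult_l_null dest: closed)
  qed
qed

lemma vect_kcategory:
  assumes "field K"
  shows "kcategory K (vect_cat K)"
proof (intro kcategory.intro kcategory_axioms.intro, goal_cases)
  case 1
  show ?case by fact
next
  case (2 V W)
  then show ?case by (simp add: vect_Hom_module)
next
  case (3 V)
  then show ?case using linear_maps_restrict[of K V "\<lambda>v. v"] by (simp add: linear_mapsI)
next
  case (4 U V W g)
  then have g: "g \<in> linear_maps K V W" and U: "module K U" by simp_all
  show ?case
  proof (rule linear_mapsI, goal_cases)
    case (1 f)
    then show ?case by (simp add: linear_maps_restrict[OF U linear_maps_comp[OF _ g]])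
  qed (auto intro!: restrict_ext simp: linear_mapsD(1)[of _ K U V] linear_mapsD(2,3)[OF g])
next
  case (5 U V W f)
  then have f: "f \<in> linear_maps K U V" and U: "module K U" by simp_all
  show ?case
  proof (rule linear_mapsI, goal_cases)
    case (1 g)
    then show ?case by (simp add: linear_maps_restrict[OF U linear_maps_comp[OF f]])
  qed (auto intro!: restrict_ext simp: linear_mapsD(1)[OF f])
next
  case (6 T U V W f g h)
  then have f: "f \<in> linear_maps K T U" by simp
  show ?case by (auto intro!: restrict_ext simp: linear_mapsD(1)[OF f])
next
  case (7 U V f)
  then have f: "f \<in> linear_maps K U V" "f \<in> extensional (carrier U)" by simp_all
  then show ?case by (auto intro!: restrict_eq_extensional simp: linear_mapsD(1)[OF f(1)])
next
  case (8 U V f)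
  then have "f \<in> extensional (carrier U)" by simp
  then show ?case by (auto intro!: restrict_eq_extensional)
qed

text \<open>Evaluation at a fixed vector is linear on the space of maps, hence commutes with finite
  sums.\<close>

lemma vect_finsum_apply:
  assumes "module K V" "module K W" "finite I" "v \<in> carrier V"
    and "f \<in> I \<rightarrow> carrier (Hom (vect_cat K) V W)"
  shows "(\<Oplus>\<^bsub>Hom (vect_cat K) V W\<^esub>i\<in>I. f i) v = (\<Oplus>\<^bsub>W\<^esub>i\<in>I. f i v)"
proof -
  have "(\<lambda>f. f v) \<in> linear_maps K (Hom (vect_cat K) V W) W"
    using assms(4) by (intro linear_mapsI) (simp_all add: linear_mapsD(1)[of _ K V W])
  from linear_maps_finsum[OF this vect_Hom_module[OF assms(1,2)] assms(2,3,5)] show ?thesis .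
qed

text \<open>The operations of \<open>V\<close> are kept and only the carrier shrinks, so the image
  lives on the same element type, with inclusion as section and \<open>e\<close> itself as
  retraction.\<close>

definition image_space :: "('k, 'v) module \<Rightarrow> ('v \<Rightarrow> 'v) \<Rightarrow> ('k, 'v) module" where
  "image_space V e = V\<lparr>carrier := e ` carrier V\<rparr>"

text \<open>Linearity closes the image under the operations, and idempotency makes \<open>e\<close>
  the identity on it.\<close>

lemma vect_split:
  fixes V :: "('k, 'v) module"
  assumes Ob: "V \<in> Ob (vect_cat K)" and e: "e \<in> carrier (Hom (vect_cat K) V V)"
    and idem: "Comp (vect_cat K) V V V e e = e"
  shows "image_space V e \<in> Ob (vect_cat K)"
    and "(\<lambda>v\<in>e ` carrier V. v) \<in> carrier (Hom (vect_cat K) (image_space V e) V)"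
    and "e \<in> carrier (Hom (vect_cat K) V (image_space V e))"
    and "Comp (vect_cat K) (image_space V e) V (image_space V e) e (\<lambda>v\<in>e ` carrier V. v) =
      Ident (vect_cat K) (image_space V e)"
    and "Comp (vect_cat K) V (image_space V e) V (\<lambda>v\<in>e ` carrier V. v) e = e"
proof -
  from Ob have V: "module K V" by simp
  then interpret V: module K V .
  have lin: "e \<in> linear_maps K V V" and ext: "e \<in> extensional (carrier V)" using e by simp_all
  note e_simps = linear_mapsD[OF lin]
  have ee: "e (e v) = e v" if "v \<in> carrier V" for v
    using fun_cong[OF idem, of v] that by simp
  have sub: "v \<in> carrier V" if "v \<in> e ` carrier V" for v
    using that e_simps(1) by auto
  have "\<zero>\<^bsub>V\<^esub> = e \<zero>\<^bsub>V\<^esub>" using linear_maps_zero[OF lin V V] by simp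
  then have zero: "\<zero>\<^bsub>V\<^esub> \<in> e ` carrier V" by blast
  have add: "u \<oplus>\<^bsub>V\<^esub> v \<in> e ` carrier V" if "u \<in> e ` carrier V" "v \<in> e ` carrier V" for u v
    using that by (auto simp: e_simps(2)[symmetric])
  have smult: "a \<odot>\<^bsub>V\<^esub> v \<in> e ` carrier V" if "a \<in> carrier K" "v \<in> e ` carrier V" for a v
    using that by (auto simp: e_simps(3)[symmetric])
  have "module K (image_space V e)"
    by (rule moduleI_null)
      (simp_all add: image_space_def V.R.is_cring zero add smult sub V.M.a_ac V.smult_l_distr
        V.smult_r_distr V.smult_assoc1)
  then show "image_space V e \<in> Ob (vect_cat K)" by simp
  show "(\<lambda>v\<in>e ` carrier V. v) \<in> carrier (Hom (vect_cat K) (image_space V e) V)"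
    by (auto intro!: linear_mapsI simp: image_space_def e_simps(1) simp: add smult)
  show "e \<in> carrier (Hom (vect_cat K) V (image_space V e))"
    using ext by (auto intro!: linear_mapsI simp: image_space_def e_simps)
  show "Comp (vect_cat K) (image_space V e) V (image_space V e) e (\<lambda>v\<in>e ` carrier V. v) =
      Ident (vect_cat K) (image_space V e)"
    by (auto intro!: restrict_ext simp: image_space_def ee)
  show "Comp (vect_cat K) V (image_space V e) V (\<lambda>v\<in>e ` carrier V. v) e = e"
    using ext by (auto intro!: restrict_eq_extensional)
qed

text \<open>Finite powers of a set of elements of an infinite type are coded inside the type: \<open>mk\<close> codes
  a family indexed by \<open>{..<n}\<close> and \<open>co\<close> reads off its members.\<close>

lemma infinite_tuple_code:
  "\<exists>(mk :: (nat \<Rightarrow> 'v::infinite) \<Rightarrow> 'v) co. (\<forall>f. \<forall>i<n. co (mk f) i = f i) \<and>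
    (\<forall>f g. (\<forall>i<n. f i = g i) \<longrightarrow> mk f = mk g)"
proof (induction n)
  case 0
  \<comment> \<open>Any two families agree on the empty index set, so the code has to be
    constant.\<close>
  show ?case by (rule exI[of _ "\<lambda>_. undefined"]) simp
next
  case (Suc n)
  then obtain mk :: "(nat \<Rightarrow> 'v) \<Rightarrow> 'v" and co where
    co: "\<And>f i. i < n \<Longrightarrow> co (mk f) i = f i" and
    mk: "\<And>f g. (\<And>i. i < n \<Longrightarrow> f i = g i) \<Longrightarrow> mk f = mk g" by blast
  \<comment> \<open>An infinite set has the cardinality of its square.\<close>
  obtain p :: "'v \<times> 'v \<Rightarrow> 'v" where "bij_betw p (UNIV \<times> UNIV) UNIV"
    using card_of_Times_same_infinite[OF infinite_UNIV[where 'a = 'v]] card_of_ordIso by blast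
  then have "inj p" by (simp add: bij_betw_def)
  then obtain q where q: "\<And>z. q (p z) = z" by (metis inv_into_f_f UNIV_I)
  \<comment> \<open>A family of length \<open>Suc n\<close> is coded as the pair of its last member,
    at index \<open>n\<close>, and the code of the first \<open>n\<close> members.\<close>
  show ?case
    by (rule exI[of _ "\<lambda>f. p (f n, mk f)"],
        rule exI[of _ "\<lambda>u i. if i = n then fst (q u) else co (snd (q u)) i"])
      (auto simp: q co less_Suc_eq intro!: arg_cong[of _ _ p] mk)
qed

text \<open>\<open>mk\<close> takes a function on all naturals; \<open>mk_cong\<close> makes it
  ignore the values from \<open>n\<close> on, so that a tuple has exactly one code and equality of
  codes can be tested on coordinates.\<close>

locale tuple_code =
  fixes n :: nat and mk :: "(nat \<Rightarrow> 'v) \<Rightarrow> 'v" and co :: "'v \<Rightarrow> nat \<Rightarrow> 'v"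
  assumes co_mk [simp]: "i < n \<Longrightarrow> co (mk f) i = f i"
    and mk_cong: "(\<And>i. i < n \<Longrightarrow> f i = g i) \<Longrightarrow> mk f = mk g"
begin

text \<open>The carrier consists of codes only: on other elements of the type \<open>co\<close>
  returns arbitrary values and need not separate points.\<close>

definition power_space :: "('k, 'v) module \<Rightarrow> ('k, 'v) module" where
  "power_space V = \<lparr>carrier = mk ` ({..<n} \<rightarrow> carrier V), mult = undefined, one = undefined,
     zero = mk (\<lambda>_. \<zero>\<^bsub>V\<^esub>), add = (\<lambda>u v. mk (\<lambda>i. co u i \<oplus>\<^bsub>V\<^esub> co v i)),
     smult = (\<lambda>a v. mk (\<lambda>i. a \<odot>\<^bsub>V\<^esub> co v i))\<rparr>"

lemma power_space_simps [simp]: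
  "\<zero>\<^bsub>power_space V\<^esub> = mk (\<lambda>_. \<zero>\<^bsub>V\<^esub>)"
  "u \<oplus>\<^bsub>power_space V\<^esub> v = mk (\<lambda>i. co u i \<oplus>\<^bsub>V\<^esub> co v i)"
  "a \<odot>\<^bsub>power_space V\<^esub> v = mk (\<lambda>i. a \<odot>\<^bsub>V\<^esub> co v i)"
  by (simp_all add: power_space_def)

lemma mk_closed: "(\<And>i. i < n \<Longrightarrow> f i \<in> carrier V) \<Longrightarrow> mk f \<in> carrier (power_space V)"
  by (auto simp: power_space_def)

lemma co_closed [simp]: "\<lbrakk>v \<in> carrier (power_space V); i < n\<rbrakk> \<Longrightarrow> co v i \<in> carrier V"
  by (auto simp: power_space_def)

lemma mk_co_eqI:
  "\<lbrakk>v \<in> carrier (power_space V); \<And>i. i < n \<Longrightarrow> f i = co v i\<rbrakk> \<Longrightarrow> mk f = v"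
  by (auto simp: power_space_def intro!: mk_cong)

lemma co_ext:
  assumes "u \<in> carrier (power_space V)" "v \<in> carrier (power_space V)"
    and "\<And>i. i < n \<Longrightarrow> co u i = co v i"
  shows "u = v"
proof -
  have "mk (co u) = u" by (rule mk_co_eqI[OF assms(1)]) simp
  moreover have "mk (co u) = v" by (rule mk_co_eqI[OF assms(2)]) (rule assms(3))
  ultimately show ?thesis by simp
qed

lemma power_space_module:
  assumes "module K V"
  shows "module K (power_space V)"
proof -
  interpret V: module K V by fact
  show ?thesis
    by (rule moduleI_null)
      (auto intro!: mk_closed mk_cong mk_co_eqI[of _ V] simp: V.R.is_cring V.M.a_ac V.smult_l_distr
        V.smult_r_distr V.smult_assoc1)
qed

definition power_inj :: "('k, 'v) module \<Rightarrow> nat \<Rightarrow> 'v \<Rightarrow> 'v" where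
  "power_inj V i = (\<lambda>v\<in>carrier V. mk (\<lambda>j. if j = i then v else \<zero>\<^bsub>V\<^esub>))"

definition power_pr :: "('k, 'v) module \<Rightarrow> nat \<Rightarrow> 'v \<Rightarrow> 'v" where
  "power_pr V i = (\<lambda>u\<in>carrier (power_space V). co u i)"

text \<open>The projection equations are read off from the codes. The substance is that the sum of
  all injections after projections is the identity, which is checked on each vector and each
  coordinate.\<close>

lemma vect_finite_powers:
  assumes "field K"
  shows "finite_powers K (vect_cat K) n power_space power_inj power_pr"
proof -
  have inj: "power_inj V i \<in> carrier (Hom (vect_cat K) V (power_space V))"
    if "module K V" "i < n" for V i
  proof -
    interpret V: module K V by fact
    show ?thesis using that(2)
      by (auto simp: power_inj_def intro!: linear_mapsI mk_closed mk_cong)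
  qed
  have pr: "power_pr V i \<in> carrier (Hom (vect_cat K) (power_space V) V)"
    if "module K V" "i < n" for V i
  proof -
    interpret P: module K "power_space V" using that(1) by (rule power_space_module)
    show ?thesis using that(2) P.M.a_closed P.smult_closed
      by (auto simp: power_pr_def intro!: linear_mapsI)
  qed
  show ?thesis
  proof (intro finite_powers.intro finite_powers_axioms.intro, goal_cases)
    case 1
    show ?case using assms by (rule vect_kcategory)
  next
    case (2 V)
    then show ?case by (simp add: power_space_module)
  next
    case (3 V i)
    then show ?case using inj by simp
  next
    case (4 V i)
    then show ?case using pr by simp
  next
    case (5 V i j)
    then interpret V: module K V by simp
    show ?case using 5 by (auto intro!: restrict_ext mk_closed simp: power_inj_def power_pr_def)
  next
    case (6 V)
    then have V: "module K V" by simp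
    then interpret V: module K V .
    note PV = power_space_module[OF V]
    interpret D: kcategory K "vect_cat K" using assms by (rule vect_kcategory)
    let ?P = "power_space V"
    let ?s = "\<Oplus>\<^bsub>Hom (vect_cat K) ?P ?P\<^esub>i\<in>{..<n}. Comp (vect_cat K) ?P V ?P (power_inj V i) (power_pr V i)"
    have closed: "(\<lambda>i. Comp (vect_cat K) ?P V ?P (power_inj V i) (power_pr V i))
        \<in> {..<n} \<rightarrow> carrier (Hom (vect_cat K) ?P ?P)"
      using V PV inj pr by (intro Pi_I D.Comp_closed) (simp_all del: vect_cat_simps(2-))
    have "?s \<in> carrier (Hom (vect_cat K) ?P ?P)"
      using PV by (intro D.Hom_finsum_closed closed) simp_all
    then have s: "?s \<in> linear_maps K ?P ?P" "?s \<in> extensional (carrier ?P)" by simp_all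
    have "?s u = u" if u: "u \<in> carrier ?P" for u
    proof (rule co_ext[of _ V])
      show "?s u \<in> carrier ?P" using linear_mapsD(1)[OF s(1) u] .
      show "u \<in> carrier ?P" by fact
      fix j
      assume j: "j < n"
      \<comment> \<open>Reading coordinate \<open>j\<close> is linear, so it passes inside the sum,
        where only the summand \<open>i = j\<close> survives.\<close>
      have co: "(\<lambda>u. co u j) \<in> linear_maps K ?P V"
        using j by (intro linear_mapsI) simp_all
      have mem: "mk (\<lambda>j. if j = i then co u i else \<zero>\<^bsub>V\<^esub>) \<in> carrier ?P" if "i < n" for i
        using u that by (intro mk_closed) simp
      have "?s u = (\<Oplus>\<^bsub>?P\<^esub>i\<in>{..<n}. Comp (vect_cat K) ?P V ?P (power_inj V i) (power_pr V i) u)"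
        by (rule vect_finsum_apply[OF PV PV _ u closed]) simp
      also have "\<dots> = (\<Oplus>\<^bsub>?P\<^esub>i\<in>{..<n}. mk (\<lambda>j. if j = i then co u i else \<zero>\<^bsub>V\<^esub>))"
        by (rule finsum_cong_index) (use u in \<open>simp_all add: power_inj_def power_pr_def\<close>)
      also have "co \<dots> j = (\<Oplus>\<^bsub>V\<^esub>i\<in>{..<n}. co (mk (\<lambda>j. if j = i then co u i else \<zero>\<^bsub>V\<^esub>)) j)"
        by (rule linear_maps_finsum[OF co PV V]) (use mem in auto)
      also have "\<dots> = (\<Oplus>\<^bsub>V\<^esub>i\<in>{..<n}. if i = j then co u i else \<zero>\<^bsub>V\<^esub>)"
        by (rule finsum_cong_index) (use j in auto)
      also have "\<dots> = co u j"
        using j u by (intro V.M.finsum_delta) simp_all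
      finally show "co (?s u) j = co u j" .
    qed
    then show ?case using s(2) by (auto intro!: restrict_eq_extensional[symmetric])
  qed
qed

end

theorem corollary4p5:
  fixes K :: "('k, 'r) ring_scheme" and C :: "('o, 'm, 'k) kcat" and n :: nat
  assumes "field K" and "kcategory K C" and "n > 0"
  shows "morita_equivalent TYPE('v::infinite) K C (matrix_cat n C)"
proof -
  obtain mk :: "(nat \<Rightarrow> 'v) \<Rightarrow> 'v" and co where "tuple_code n mk co"
    using infinite_tuple_code[of n] unfolding tuple_code_def by metis
  then interpret T: tuple_code n mk co .
  \<comment> \<open>Idempotents are split by their images: the section is the inclusion and the
    retraction is the idempotent itself.\<close>
  have "matrix_equivalence K (vect_cat K) n T.power_space T.power_inj T.power_pr C image_space
      (\<lambda>V e. \<lambda>v\<in>e ` carrier V. v) (\<lambda>V e. e)"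
    by (intro matrix_equivalence.intro matrix_equivalence_axioms.intro T.vect_finite_powers assms)
      (intro conjI vect_split; assumption)+
  from matrix_equivalence.functor_cat_matrix_equivalent[OF this] show ?thesis
    using assms(2) kcategory.matrix_kcategory[OF assms(2)]
    by (simp add: morita_equivalent_def left_modules_def)
qed

end
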